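(* Let $\varphi$ be a non-constant analytic function in the unit disk $\mathbb{D}$ with $\varphi(\mathbb{D})\subset\mathbb{D}$. Suppose that $\varphi$ is locally univalent and that $A_\varphi(z)\neq 0$ for all $z\in\mathbb{D}$. Let $c=\inf_{z\in\mathbb{D}}|D_\varphi(z)|$ and $d=\sup_{z\in\mathbb{D}}|D_\varphi(z)|$. If $\omega^-=c$ and $\omega^+=d$ for all trajectories of $\varphi$, then the level set $C_\varphi(t)$ is an open Jordan arc for all $t\in(c,d)$. Furthermore, $B:=\bigcap_{t\in(c,d)}\overline{B(t)}$ is a compact connected subset of the unit circle $\mathbb{T}$ such that any trajectory of $\varphi$ ends on $B$.
   Context: $\mathbb{D}$ is the open unit disk in $\mathbb{C}$ and $\mathbb{T}=\partial\mathbb{D}$. For $\varphi:\mathbb{D}\to\mathbb{D}$ analytic and non-constant, define $$D_\varphi(z)=\frac{(1-|z|^2)\varphi'(z)}{1-|\varphi(z)|^2},\qquad A_\varphi(z)=\frac{1-|z|^2}{2}\frac{\varphi''(z)}{\varphi'(z)}-\bar z+\frac{(1-|z|^2)\overline{\varphi(z)}\varphi'(z)}{1-|\varphi(z)|^2},$$ with $A_\varphi(z)=\infty$ at the zeros of $\varphi'$. The level sets are $C_\varphi(t)=\{z\in\mathbb{D}:|D_\varphi(z)|=t\}$, and $$B(t)=\{z\in\mathbb{D}:|D_\varphi(z)|\geq t\},\quad t\in(c,d);$$ $\overline{B(t)}$ is its closure in $\mathbb{C}$. Let $E=\{z\in\mathbb{D}: \varphi'(z)\neq 0,\ A_\varphi(z)\neq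 0\}$. For $z_0\in E$ put $t_0=|D_\varphi(z_0)|\in(0,1)$. The trajectory of $\varphi$ through $z_0$ is the unique maximal solution $z(t)$, $t\in(\omega^-,\omega^+)$, of the initial value problem $$z'(t)=\frac{1-|z(t)|^2}{2t\,A_\varphi(z(t))},\qquad z(t_0)=z_0,$$ considered in the domain $(t,z)\in(0,1)\times E$. With this choice $|D_\varphi(z(t))|=t$ for all $t\in(\omega^-,\omega^+)$. The numbers $\omega^\pm$ are the endpoints of the maximal interval of the trajectory in question. With $\Gamma^+=\{z(t):t_0\le t<\omega^+\}$, the trajectory is said to end on $B$ if $\overline{\Gamma^+}\setminus\Gamma^+\subset B$. *)

theory Defs
  imports "HOL-Complex_Analysis.Complex_Analysis"
begin

definition hyp_deriv :: "(complex \<Rightarrow> complex) \<Rightarrow> complex \<Rightarrow> complex" where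
  "hyp_deriv \<phi> z =
     of_real (1 - (cmod z)\<^sup>2) * deriv \<phi> z / of_real (1 - (cmod (\<phi> z))\<^sup>2)"

text \<open>
  The function \<open>A\<^sub>\<phi>\<close> is given the value \<open>\<infinity>\<close> at the zeros of \<open>\<phi>'\<close>. The complex-valued function
  below has the value \<open>-cnj z\<close> there (division by zero is zero), so it is to be used
  only where \<open>\<phi>'\<close> does not vanish; this is why \<open>traj_dom\<close> excludes the zeros of \<open>\<phi>'\<close> explicitly.
\<close>

definition A_fun :: "(complex \<Rightarrow> complex) \<Rightarrow> complex \<Rightarrow> complex" where
  "A_fun \<phi> z =
     of_real ((1 - (cmod z)\<^sup>2) / 2) * (deriv (deriv \<phi>) z / deriv \<phi> z) - cnj z
     + of_real (1 - (cmod z)\<^sup>2) * cnj (\<phi> z) * deriv \<phi> z / of_real (1 - (cmod (\<phi> z))\<^sup>2)"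

definition level_set :: "(complex \<Rightarrow> complex) \<Rightarrow> real \<Rightarrow> complex set" where
  "level_set \<phi> t = {z \<in> ball 0 1. cmod (hyp_deriv \<phi> z) = t}"

definition superlevel_set :: "(complex \<Rightarrow> complex) \<Rightarrow> real \<Rightarrow> complex set" where
  "superlevel_set \<phi> t = {z \<in> ball 0 1. cmod (hyp_deriv \<phi> z) \<ge> t}"

definition locally_univalent_on :: "(complex \<Rightarrow> complex) \<Rightarrow> complex set \<Rightarrow> bool" where
  "locally_univalent_on \<phi> S \<longleftrightarrow>
     (\<forall>z\<in>S. \<exists>U. open U \<and> z \<in> U \<and> U \<subseteq> S \<and> inj_on \<phi> U)"

definition open_Jordan_arc :: "complex set \<Rightarrow> bool" where
  "open_Jordan_arc S \<longleftrightarrow> S homeomorphic {0<..<1::real}"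

definition traj_dom :: "(complex \<Rightarrow> complex) \<Rightarrow> complex set" where
  "traj_dom \<phi> = {z \<in> ball 0 1. deriv \<phi> z \<noteq> 0 \<and> A_fun \<phi> z \<noteq> 0}"

text \<open>
  Solutions of the initial value problem are considered on open intervals \<open>(a, b)\<close> inside
  \<open>(0, 1)\<close>; the values of \<open>w\<close> outside \<open>(a, b)\<close> are irrelevant.
\<close>

definition ivp_solution ::
  "(complex \<Rightarrow> complex) \<Rightarrow> complex \<Rightarrow> real \<Rightarrow> real \<Rightarrow> (real \<Rightarrow> complex) \<Rightarrow> bool" where
  "ivp_solution \<phi> z0 a b w \<longleftrightarrow>
     0 \<le> a \<and> b \<le> 1 \<and> cmod (hyp_deriv \<phi> z0) \<in> {a<..<b} \<and> w (cmod (hyp_deriv \<phi> z0)) = z0 \<and>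
     (\<forall>t\<in>{a<..<b}. w t \<in> traj_dom \<phi> \<and>
        (w has_vector_derivative
          of_real (1 - (cmod (w t))\<^sup>2) / (2 * of_real t * A_fun \<phi> (w t))) (at t))"

definition trajectory ::
  "(complex \<Rightarrow> complex) \<Rightarrow> complex \<Rightarrow> real \<Rightarrow> real \<Rightarrow> (real \<Rightarrow> complex) \<Rightarrow> bool" where
  "trajectory \<phi> z0 a b w \<longleftrightarrow>
     z0 \<in> traj_dom \<phi> \<and> ivp_solution \<phi> z0 a b w \<and>
     (\<forall>a' b' w'. ivp_solution \<phi> z0 a' b' w' \<and> a' \<le> a \<and> b \<le> b' \<and> (\<forall>t\<in>{a<..<b}. w' t = w t)
        \<longrightarrow> a' = a \<and> b' = b)"

definition forward_part ::
  "(complex \<Rightarrow> complex) \<Rightarrow> complex \<Rightarrow> real \<Rightarrow> (real \<Rightarrow> complex) \<Rightarrow> complex set" where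
  "forward_part \<phi> z0 b w = w ` {cmod (hyp_deriv \<phi> z0)..<b}"

definition ends_on ::
  "(complex \<Rightarrow> complex) \<Rightarrow> complex \<Rightarrow> real \<Rightarrow> (real \<Rightarrow> complex) \<Rightarrow> complex set \<Rightarrow> bool" where
  "ends_on \<phi> z0 b w B \<longleftrightarrow>
     closure (forward_part \<phi> z0 b w) - forward_part \<phi> z0 b w \<subseteq> B"

end

theory Submission
  imports Defs
begin

text \<open>
  Write \<open>u z\<close> for the modulus of the hyperbolic derivative. Since
  \<open>d (ln u) h = 2 Re (A h) / (1 - \<bar>z\<bar>\<^sup>2)\<close>, the hypothesis \<open>A \<noteq> 0\<close> says that \<open>u\<close> has no critical points in
  the disc, in particular no extrema. A trajectory is an integral curve along which \<open>u\<close> grows at unit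
  speed; it is parametrised by the value of \<open>u\<close>.

  If every trajectory runs through all values in \<open>(c, d)\<close>, then each point of the disc can be moved along
  its trajectory until \<open>u\<close> has a prescribed value \<open>t\<close>, and the result depends continuously on the point
  (\<open>ode_flow_isCont\<close>). This maps the disc onto the level set of \<open>t\<close>, and, if only the points with
  \<open>u z < t\<close> are moved, onto the superlevel set. Both are therefore connected (\<open>connected_sets\<close>).

  A connected level set is an arc for the following reason. The gradient of \<open>ln u\<close> turned by a right angle
  is tangent to the level sets. Scaled so that its hyperbolic length is bounded, it has solutions for all
  real times (\<open>level_flow_exists\<close>). Its orbits are open in the level set
  (\<open>level_orbit_neighbourhood\<close>), so the level set is a single orbit. A periodic orbit would make the level
  set compact; then \<open>u\<close> would lie on one side of \<open>t\<close> near the unit circle and would have an extremum in the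
  disc (\<open>level_set_not_compact\<close>). So the orbit is an injective, continuous and open image of the line.

  The closures of the superlevel sets form a chain of compact connected sets, so their intersection \<open>B\<close> is
  compact and connected. It contains no point of the disc because \<open>u < d\<close> there. After the time \<open>t\<close> a
  trajectory stays in the superlevel set of \<open>t\<close>, and the part before is compact; hence limit points
  outside the trajectory belong to \<open>B\<close>.

  Both fields are locally Lipschitz. For such fields Picard iteration yields local solutions, uniqueness
  and Lipschitz dependence on the initial value; maximal solutions, a criterion for global existence and
  the continuity of the flow follow from these.
\<close>

section \<open>Locally Lipschitz maps\<close>

text \<open>
  A local Lipschitz condition at one point. The algebraic closure properties below hold pointwise,
  so they establish the condition for a vector field given by a formula without any
  differentiation.
\<close>

definition lipschitz_near :: "'a::metric_space \<Rightarrow> ('a \<Rightarrow> 'b::metric_space) \<Rightarrow> bool" where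
  "lipschitz_near p f \<longleftrightarrow> (\<exists>r>0. \<exists>L. L-lipschitz_on (cball p r) f)"

lemma lipschitz_nearI: "0 < r \<Longrightarrow> L-lipschitz_on (cball p r) f \<Longrightarrow> lipschitz_near p f"
  unfolding lipschitz_near_def by blast

lemma lipschitz_near2E:
  assumes "lipschitz_near p f" "lipschitz_near p g"
  obtains r L where "0 < r" "L-lipschitz_on (cball p r) f" "L-lipschitz_on (cball p r) g"
proof -
  obtain r1 L1 r2 L2 where *: "0 < r1" "L1-lipschitz_on (cball p r1) f"
      "0 < r2" "L2-lipschitz_on (cball p r2) g"
    using assms unfolding lipschitz_near_def by blast
  show thesis
  proof (rule that[of "min r1 r2" "max L1 L2"])
    show "(max L1 L2)-lipschitz_on (cball p (min r1 r2)) f"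
      by (rule lipschitz_on_mono[OF *(2)]) auto
    show "(max L1 L2)-lipschitz_on (cball p (min r1 r2)) g"
      by (rule lipschitz_on_mono[OF *(4)]) auto
  qed (use * in auto)
qed

lemma lipschitz_near_const: "lipschitz_near p (\<lambda>x. c)"
  by (rule lipschitz_nearI[of 1]) (auto intro: lipschitz_intros)

lemma lipschitz_near_id: "lipschitz_near p (\<lambda>x. x)"
  by (rule lipschitz_nearI[of 1]) (auto intro: lipschitz_intros)

lemma lipschitz_near_compose:
  assumes "lipschitz_near p f" "C-lipschitz_on UNIV g"
  shows "lipschitz_near p (\<lambda>x. g (f x))"
proof -
  obtain r L where "0 < r" "L-lipschitz_on (cball p r) f"
    using assms unfolding lipschitz_near_def by blast
  then show ?thesis
    by (intro lipschitz_nearI[of r "C * L"] lipschitz_on_compose2)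
       (auto intro: lipschitz_on_subset[OF assms(2)])
qed

lemma lipschitz_near_norm:
  "lipschitz_near p f \<Longrightarrow> lipschitz_near p (\<lambda>x. norm (f x :: 'b::real_normed_vector))"
  by (erule lipschitz_near_compose[of _ _ 1])
     (auto intro!: lipschitz_onI simp: dist_norm norm_triangle_ineq3)

lemma lipschitz_near_of_real:
  "lipschitz_near p f \<Longrightarrow> lipschitz_near p (\<lambda>x. of_real (f x) :: 'b::real_normed_algebra_1)"
  by (erule lipschitz_near_compose[of _ _ 1])
     (auto intro!: lipschitz_onI simp: dist_norm simp flip: of_real_diff)

lemma lipschitz_near_cnj: "lipschitz_near p f \<Longrightarrow> lipschitz_near p (\<lambda>x. cnj (f x))"
  by (erule lipschitz_near_compose[of _ _ 1])
     (auto intro!: lipschitz_onI simp: dist_norm simp flip: complex_cnj_diff)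

lemma lipschitz_near_add:
  fixes f g :: "'a::metric_space \<Rightarrow> 'b::real_normed_vector"
  assumes "lipschitz_near p f" "lipschitz_near p g"
  shows "lipschitz_near p (\<lambda>x. f x + g x)"
  by (rule lipschitz_near2E[OF assms]) (blast intro: lipschitz_nearI lipschitz_on_add)

lemma lipschitz_near_diff:
  fixes f g :: "'a::metric_space \<Rightarrow> 'b::real_normed_vector"
  assumes "lipschitz_near p f" "lipschitz_near p g"
  shows "lipschitz_near p (\<lambda>x. f x - g x)"
  by (rule lipschitz_near2E[OF assms]) (blast intro: lipschitz_nearI lipschitz_on_diff)

text \<open>
  A Lipschitz function is bounded on a ball, and \<open>f x g x - f y g y = f x (g x - g y) + (f x - f y) g y\<close>.
\<close>

lemma lipschitz_near_mult:
  fixes f g :: "'a::metric_space \<Rightarrow> 'b::real_normed_algebra"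
  assumes "lipschitz_near p f" "lipschitz_near p g"
  shows "lipschitz_near p (\<lambda>x. f x * g x)"
proof (rule lipschitz_near2E[OF assms])
  fix r L assume r: "0 < r" and f: "L-lipschitz_on (cball p r) f" and g: "L-lipschitz_on (cball p r) g"
  have L: "0 \<le> L" using f lipschitz_on_nonneg by blast
  define M where "M = max (norm (f p)) (norm (g p)) + L * r"
  have M0: "0 \<le> M" using L r by (auto simp: M_def le_max_iff_disj intro!: add_nonneg_nonneg)
  have bound: "norm (h x) \<le> M" if "L-lipschitz_on (cball p r) h" "norm (h p) \<le> max (norm (f p)) (norm (g p))"
      "x \<in> cball p r" for h :: "'a \<Rightarrow> 'b" and x
  proof -
    have "norm (h x - h p) \<le> L * dist x p"
      using lipschitz_onD[OF that(1), of x p] that(3) r by (auto simp: dist_norm)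
    also have "\<dots> \<le> L * r" using that(3) L by (intro mult_left_mono) (auto simp: dist_commute)
    finally show ?thesis using that(2) norm_triangle_sub[of "h x" "h p"] by (simp add: M_def)
  qed
  show ?thesis
  proof (rule lipschitz_nearI[OF r, of "2 * M * L"], rule lipschitz_onI)
    fix x y assume xy: "x \<in> cball p r" "y \<in> cball p r"
    have "f x * g x - f y * g y = f x * (g x - g y) + (f x - f y) * g y"
      by (simp add: algebra_simps)
    then have "norm (f x * g x - f y * g y) \<le> norm (f x * (g x - g y)) + norm ((f x - f y) * g y)"
      by (metis norm_triangle_ineq)
    also have "\<dots> \<le> norm (f x) * norm (g x - g y) + norm (f x - f y) * norm (g y)"
      by (intro add_mono norm_mult_ineq)
    also have "\<dots> \<le> M * (L * dist x y) + (L * dist x y) * M"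
      using lipschitz_onD[OF f xy] lipschitz_onD[OF g xy] bound[OF f _ xy(1)] bound[OF g _ xy(2)] M0 L
      by (intro add_mono mult_mono) (auto simp: dist_norm)
    finally show "dist (f x * g x) (f y * g y) \<le> 2 * M * L * dist x y"
      by (simp add: dist_norm algebra_simps)
  qed (use L M0 in auto)
qed

text \<open>
  On a ball of radius \<open>s\<close> with \<open>L s \<le> \<bar>f p\<bar> / 2\<close> the function stays at distance at least
  \<open>\<bar>f p\<bar> / 2\<close> from 0, so the difference quotient of the reciprocals is bounded.
\<close>

lemma lipschitz_near_inverse:
  fixes f :: "'a::metric_space \<Rightarrow> 'b::real_normed_div_algebra"
  assumes "lipschitz_near p f" "f p \<noteq> 0"
  shows "lipschitz_near p (\<lambda>x. inverse (f x))"
proof -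
  obtain r L where r: "0 < r" and f: "L-lipschitz_on (cball p r) f"
    using assms unfolding lipschitz_near_def by blast
  have L: "0 \<le> L" using f lipschitz_on_nonneg by blast
  define m where "m = norm (f p) / 2"
  have m: "0 < m" using assms by (simp add: m_def)
  define s where "s = min r (m / (L + 1))"
  have s: "0 < s" "s \<le> r" using r m L by (auto simp: s_def)
  have Ls: "L * s \<le> m"
  proof -
    have "L * s \<le> (L + 1) * (m / (L + 1))" using L s by (intro mult_mono) (auto simp: s_def)
    then show ?thesis using L by auto
  qed
  have low: "m \<le> norm (f x)" if "x \<in> cball p s" for x
  proof -
    have "norm (f p - f x) \<le> L * dist p x"
      using lipschitz_onD[OF f, of p x] that s r by (auto simp: dist_norm)
    also have "\<dots> \<le> L * s" using that L by (intro mult_left_mono) auto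
    finally show ?thesis using Ls norm_triangle_sub[of "f p" "f x"] by (simp add: m_def)
  qed
  show ?thesis
  proof (rule lipschitz_nearI[OF s(1), of "L / (m * m)"], rule lipschitz_onI)
    fix x y assume xy: "x \<in> cball p s" "y \<in> cball p s"
    have nz: "f x \<noteq> 0" "f y \<noteq> 0" using low[OF xy(1)] low[OF xy(2)] m by auto
    have "dist (inverse (f x)) (inverse (f y)) = norm (f x - f y) / (norm (f x) * norm (f y))"
      by (simp add: dist_norm inverse_diff_inverse[OF nz] norm_mult norm_inverse divide_inverse)
    also have "\<dots> \<le> (L * dist x y) / (m * m)"
      using lipschitz_onD[OF f, of x y] xy s low[OF xy(1)] low[OF xy(2)] m L
      by (intro frac_le mult_mono) (auto simp: dist_norm)
    finally show "dist (inverse (f x)) (inverse (f y)) \<le> L / (m * m) * dist x y" by simp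
  qed (use L m in auto)
qed

lemma lipschitz_near_divide:
  fixes f g :: "'a::metric_space \<Rightarrow> 'b::real_normed_field"
  assumes "lipschitz_near p f" "lipschitz_near p g" "g p \<noteq> 0"
  shows "lipschitz_near p (\<lambda>x. f x / g x)"
  using lipschitz_near_mult[OF assms(1) lipschitz_near_inverse[OF assms(2,3)]]
  by (simp add: divide_inverse)

lemma lipschitz_near_power2:
  fixes f :: "'a::metric_space \<Rightarrow> 'b::real_normed_algebra_1"
  assumes "lipschitz_near p f"
  shows "lipschitz_near p (\<lambda>x. (f x)\<^sup>2)"
  unfolding power2_eq_square by (rule lipschitz_near_mult[OF assms assms])

text \<open>
  The derivative is continuous, hence bounded on a compact ball, and a ball is convex.
\<close>

lemma lipschitz_near_holomorphic:
  assumes "f holomorphic_on S" "open S" "p \<in> S"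
  shows "lipschitz_near p f"
proof -
  obtain r where r: "0 < r" "cball p r \<subseteq> S" using assms open_contains_cball by blast
  have "continuous_on (cball p r) (deriv f)"
    using assms r by (meson holomorphic_deriv holomorphic_on_imp_continuous_on continuous_on_subset)
  then have "bounded (deriv f ` cball p r)"
    by (intro compact_imp_bounded compact_continuous_image) auto
  then obtain L where L: "0 < L" "\<And>z. z \<in> cball p r \<Longrightarrow> norm (deriv f z) \<le> L"
    by (auto simp: bounded_pos)
  show ?thesis
  proof (rule lipschitz_nearI[OF r(1), of L], rule lipschitz_onI)
    fix x y assume xy: "x \<in> cball p r" "y \<in> cball p r"
    have "norm (f x - f y) \<le> L * norm (x - y)"
    proof (rule field_differentiable_bound[OF convex_cball _ L(2) xy])
      fix z assume "z \<in> cball p r"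
      then show "(f has_field_derivative deriv f z) (at z within cball p r)"
        using assms r by (meson holomorphic_derivI has_field_derivative_at_within subsetD)
    qed auto
    then show "dist (f x) (f y) \<le> L * dist x y" by (simp add: dist_norm)
  qed (use L in auto)
qed

lemma lipschitz_near_isCont:
  assumes "lipschitz_near p f" shows "isCont f p"
proof -
  obtain r L where "0 < r" "L-lipschitz_on (cball p r) f"
    using assms unfolding lipschitz_near_def by blast
  then have "continuous_on (ball p r) f" 
    using lipschitz_on_continuous_on continuous_on_subset ball_subset_cball by blast
  then show ?thesis using \<open>0 < r\<close> by (simp add: continuous_on_eq_continuous_at)
qed

section \<open>Autonomous differential equations\<close>

text \<open>
  Solutions of \<open>w' = f w\<close> that stay in \<open>S\<close>. The time domain is part of the notion, and it is an
  arbitrary open interval, bounded or not.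
\<close>

definition ode_solution ::
  "('a::real_normed_vector \<Rightarrow> 'a) \<Rightarrow> 'a set \<Rightarrow> real set \<Rightarrow> (real \<Rightarrow> 'a) \<Rightarrow> bool" where
  "ode_solution f S I w \<longleftrightarrow> open I \<and> connected I \<and>
     (\<forall>t\<in>I. w t \<in> S \<and> (w has_vector_derivative f (w t)) (at t))"

lemma ode_solutionD:
  assumes "ode_solution f S I w"
  shows "open I" "connected I" "\<And>t. t \<in> I \<Longrightarrow> w t \<in> S"
    "\<And>t. t \<in> I \<Longrightarrow> (w has_vector_derivative f (w t)) (at t)"
    "\<And>t. t \<in> I \<Longrightarrow> isCont w t" "continuous_on I w"
proof -
  show "open I" "connected I" "\<And>t. t \<in> I \<Longrightarrow> w t \<in> S"
    and w': "\<And>t. t \<in> I \<Longrightarrow> (w has_vector_derivative f (w t)) (at t)"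
    using assms unfolding ode_solution_def by auto
  show "isCont w t" if "t \<in> I" for t
    using has_vector_derivative_continuous[OF w'[OF that]] .
  then show "continuous_on I w" by (simp add: continuous_at_imp_continuous_on)
qed

lemma ode_solution_subset:
  "ode_solution f S I w \<Longrightarrow> open J \<Longrightarrow> connected J \<Longrightarrow> J \<subseteq> I \<Longrightarrow> ode_solution f S J w"
  unfolding ode_solution_def by blast

lemma ode_solution_shift:
  assumes "ode_solution f S I w"
  shows "ode_solution f S ((+) \<sigma> -` I) (\<lambda>t. w (\<sigma> + t))"
  unfolding ode_solution_def
proof (intro conjI ballI)
  show "open ((+) \<sigma> -` I)"
    using ode_solutionD(1)[OF assms] by (intro open_vimage) (auto intro: continuous_intros)
  have "(+) \<sigma> -` I = (+) (- \<sigma>) ` I"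
    by (force simp: image_iff)
  then show "connected ((+) \<sigma> -` I)"
    using ode_solutionD(2)[OF assms]
    by (auto intro!: connected_continuous_image continuous_intros)
  fix t assume "t \<in> (+) \<sigma> -` I"
  then have t: "\<sigma> + t \<in> I" by auto
  show "w (\<sigma> + t) \<in> S" using ode_solutionD(3)[OF assms t] .
  have "((+) \<sigma> has_vector_derivative 1) (at t)"
    by (auto intro!: derivative_eq_intros)
  from vector_diff_chain_at[OF this ode_solutionD(4)[OF assms t]]
  show "((\<lambda>t. w (\<sigma> + t)) has_vector_derivative f (w (\<sigma> + t))) (at t)"
    by (simp add: o_def)
qed

text \<open>
  Let \<open>M\<close> be the maximum of \<open>\<bar>x - y\<bar>\<close> on the compact interval between the initial time and \<open>s\<close>, extended
  symmetrically. The derivative of \<open>x - y\<close> is at most \<open>L M\<close> there, so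
  \<open>M \<le> \<bar>x t0 - y t0\<bar> + L \<epsilon> M \<le> \<bar>x t0 - y t0\<bar> + M / 2\<close>. On short intervals this takes the place of
  Gronwall's inequality. It gives both uniqueness and Lipschitz dependence on the initial value.
\<close>

lemma ode_solution_dist_le:
  assumes x: "\<And>t. t \<in> ball t0 \<epsilon> \<Longrightarrow> (x has_vector_derivative f (x t)) (at t)" "\<And>t. t \<in> ball t0 \<epsilon> \<Longrightarrow> x t \<in> K"
    and y: "\<And>t. t \<in> ball t0 \<epsilon> \<Longrightarrow> (y has_vector_derivative f (y t)) (at t)" "\<And>t. t \<in> ball t0 \<epsilon> \<Longrightarrow> y t \<in> K"
    and f: "L-lipschitz_on K f" and \<epsilon>: "L * \<epsilon> \<le> 1 / 2" and s: "s \<in> ball t0 \<epsilon>"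
  shows "dist (x s) (y s) \<le> 2 * dist (x t0) (y t0)"
proof -
  define h where "h = dist t0 s"
  define e where "e = (\<lambda>t. x t - y t)"
  have sub: "cball t0 h \<subseteq> ball t0 \<epsilon>" and sh: "s \<in> cball t0 h" "t0 \<in> cball t0 h" and h0: "0 \<le> h" "h \<le> \<epsilon>"
    using s by (auto simp: h_def)
  have L: "0 \<le> L" using f lipschitz_on_nonneg by blast
  have e': "(e has_vector_derivative f (x t) - f (y t)) (at t within cball t0 h)" if "t \<in> cball t0 h" for t
    unfolding e_def
    by (intro has_vector_derivative_diff x(1)[THEN has_vector_derivative_at_within]
        y(1)[THEN has_vector_derivative_at_within] subsetD[OF sub that])
  have "continuous_on (cball t0 h) (\<lambda>t. norm (e t))"
    unfolding continuous_on_eq_continuous_within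
    by (intro ballI continuous_norm has_vector_derivative_continuous[OF e'])
  from continuous_attains_sup[OF compact_cball _ this]
  obtain m where m: "m \<in> cball t0 h" "\<And>t. t \<in> cball t0 h \<Longrightarrow> norm (e t) \<le> norm (e m)"
    using sh by auto
  have "norm (e m - e t0) \<le> (L * norm (e m)) * norm (m - t0)"
  proof (rule differentiable_bound[OF convex_cball _ _ m(1) sh(2)])
    fix t assume t: "t \<in> cball t0 h"
    show "(e has_derivative (\<lambda>u. u *\<^sub>R (f (x t) - f (y t)))) (at t within cball t0 h)"
      using e'[OF t] by (simp add: has_vector_derivative_def)
    have "norm (f (x t) - f (y t)) \<le> L * norm (e t)"
      using lipschitz_onD[OF f x(2) y(2), OF subsetD[OF sub t] subsetD[OF sub t]] by (simp add: dist_norm e_def)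
    also have "\<dots> \<le> L * norm (e m)" using m(2)[OF t] L by (intro mult_left_mono)
    finally have *: "norm (f (x t) - f (y t)) \<le> L * norm (e m)" .
    show "onorm (\<lambda>u. u *\<^sub>R (f (x t) - f (y t))) \<le> L * norm (e m)"
      by (rule onorm_le) (use mult_left_mono[OF *] in \<open>auto simp: mult.commute\<close>)
  qed
  also have "\<dots> \<le> (L * norm (e m)) * \<epsilon>"
    using m(1) h0 L by (intro mult_left_mono) (auto simp: dist_norm norm_minus_commute)
  also have "\<dots> = (L * \<epsilon>) * norm (e m)" by simp
  also have "\<dots> \<le> 1 / 2 * norm (e m)" using \<epsilon> by (intro mult_right_mono) auto
  finally have "norm (e m) \<le> 2 * norm (e t0)"
    using norm_triangle_sub[of "e m" "e t0"] by simp
  with m(2)[OF sh(1)] show ?thesis by (simp add: e_def dist_norm)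
qed

text \<open>
  The set where two solutions agree is closed by continuity, and it is open by the estimate above:
  near a common value the distance of the solutions is at most twice zero.
\<close>

lemma ode_solution_unique:
  assumes f: "\<forall>p\<in>S. lipschitz_near p f"
    and x: "ode_solution f S I x" and y: "ode_solution f S I y"
    and t0: "t0 \<in> I" "x t0 = y t0" and t: "t \<in> I"
  shows "x t = y t"
proof -
  have "I = {t \<in> I. x t = y t}"
  proof -
    let ?E = "{t \<in> I. x t = y t}"
    have "closedin (top_of_set I) ?E"
      using continuous_closedin_preimage_constant[of I "\<lambda>t. x t - y t" 0]
        ode_solutionD(6)[OF x] ode_solutionD(6)[OF y]
      by (simp add: continuous_on_diff)
    moreover have "open ?E"
      unfolding open_contains_ball
    proof
      fix t1 assume t1: "t1 \<in> ?E"
      then have "lipschitz_near (x t1) f" using bspec[OF f ode_solutionD(3)[OF x, of t1]] by simp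
      then obtain r L where r: "0 < r" and L: "L-lipschitz_on (cball (x t1) r) f"
        unfolding lipschitz_near_def by blast
      have L0: "0 \<le> L" using L lipschitz_on_nonneg by blast
      have near: "\<exists>d>0. \<forall>t. dist t t1 < d \<longrightarrow> z t \<in> cball (x t1) r"
        if z: "ode_solution f S I z" "z t1 = x t1" for z
        using ode_solutionD(5)[OF z(1), of t1] t1 r z(2) 
        unfolding continuous_at_eps_delta by (force simp: dist_commute intro: less_imp_le)
      obtain d1 where d1: "0 < d1" "\<And>t. dist t t1 < d1 \<Longrightarrow> x t \<in> cball (x t1) r"
        using near[OF x] by auto
      obtain d2 where d2: "0 < d2" "\<And>t. dist t t1 < d2 \<Longrightarrow> y t \<in> cball (x t1) r"
        using near[OF y] t1 by auto
      obtain d3 where d3: "0 < d3" "ball t1 d3 \<subseteq> I"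
        using ode_solutionD(1)[OF x] t1 open_contains_ball by blast
      define \<epsilon> where "\<epsilon> = min (min d1 d2) (min d3 (1 / (2 * (L + 1))))"
      have \<epsilon>: "0 < \<epsilon>" using d1 d2 d3 L0 by (auto simp: \<epsilon>_def)
      have "L * \<epsilon> \<le> (L + 1) * (1 / (2 * (L + 1)))"
        using L0 \<epsilon> by (intro mult_mono) (auto simp: \<epsilon>_def)
      also have "\<dots> = 1 / 2" using L0 by (simp add: divide_simps)
  finally have L\<epsilon>: "L * \<epsilon> \<le> 1 / 2" .
      have "x s = y s" if s: "s \<in> ball t1 \<epsilon>" for s
      proof -
        have "dist (x s) (y s) \<le> 2 * dist (x t1) (y t1)"
          by (rule ode_solution_dist_le[OF _ _ _ _ L L\<epsilon> s])
            (use d1 d2 d3 ode_solutionD(4)[OF x] ode_solutionD(4)[OF y] in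
              \<open>auto simp: \<epsilon>_def dist_commute subset_iff\<close>)
        then show ?thesis using t1 by simp
      qed
      then show "\<exists>e>0. ball t1 e \<subseteq> ?E"
        using \<epsilon> d3 by (intro exI[of _ \<epsilon>]) (auto simp: \<epsilon>_def subset_iff)
    qed
    then have "openin (top_of_set I) ?E" by (auto intro: open_subset)
    ultimately have "?E = {} \<or> ?E = I"
      using ode_solutionD(2)[OF x] connected_clopen by blast
    then show ?thesis using t0 by blast
  qed
  with t show ?thesis by blast
qed

text \<open>
  Picard iteration as a contraction of the space of bounded continuous functions. The field is
  assumed bounded and Lipschitz on the whole space, so that no iterate can leave its domain.
\<close>

lemma picard_lindelof_bounded:
  fixes F :: "'a::euclidean_space \<Rightarrow> 'a"
  assumes F: "L-lipschitz_on UNIV F" and M: "\<And>z. norm (F z) \<le> M"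
    and \<epsilon>: "0 < \<epsilon>" "L * \<epsilon> \<le> 1 / 2"
  shows "\<exists>w. w 0 = z \<and> (\<forall>t\<in>ball 0 \<epsilon>. (w has_vector_derivative F (w t)) (at t) \<and> dist z (w t) \<le> M * \<epsilon>)"
proof -
  define J where "J = {-\<epsilon>..\<epsilon>}"
  have L0: "0 \<le> L" using F lipschitz_on_nonneg by blast
  have M0: "0 \<le> M" using M[of 0] norm_ge_zero order_trans by blast
  have contF: "continuous_on UNIV F" using F lipschitz_on_continuous_on by blast
  have J0: "0 \<in> J" using \<epsilon> by (auto simp: J_def)
  \<comment> \<open>Subtracting the integral up to 0 puts the initial time in the middle of the interval, so that
    forward and backward time need no separate treatment.\<close>
  define P where "P = (\<lambda>(x :: real \<Rightarrow>\<^sub>C 'a) t. z +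
    (integral {-\<epsilon>..t} (\<lambda>s. F (x s)) - integral {-\<epsilon>..0} (\<lambda>s. F (x s))))"
  have P': "(P x has_vector_derivative F (x t)) (at t within J)" if "t \<in> J" for x t
  proof -
    have "continuous_on {-\<epsilon>..\<epsilon>} (\<lambda>s. F (x s))"
      by (rule continuous_on_compose2[OF contF]) auto
    from integral_has_vector_derivative[OF this, of t] that
    show ?thesis unfolding P_def J_def by (auto intro!: derivative_eq_intros)
  qed
  have P0: "P x 0 = z" for x by (simp add: P_def)
  have mv: "norm (g t) \<le> C * \<epsilon>" if "g 0 = 0"
      and "\<And>s. s \<in> J \<Longrightarrow> (g has_vector_derivative g' s) (at s within J)"
      and "\<And>s. s \<in> J \<Longrightarrow> norm (g' s) \<le> C" and t: "t \<in> J" for g :: "real \<Rightarrow> 'a" and g' C t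
  proof -
    have C0: "0 \<le> C" using that(3)[OF t] norm_ge_zero order_trans by blast
    have "norm (g t - g 0) \<le> C * norm (t - 0)"
    proof (rule differentiable_bound[OF _ _ _ t J0])
      show "convex J" by (simp add: J_def)
      fix s assume s: "s \<in> J"
      show "(g has_derivative (\<lambda>u. u *\<^sub>R g' s)) (at s within J)"
        using that(2)[OF s] by (simp add: has_vector_derivative_def)
      show "onorm (\<lambda>u. u *\<^sub>R g' s) \<le> C"
        by (rule onorm_le) (use that(3)[OF s] in \<open>auto simp: mult.commute[of C] intro: mult_left_mono\<close>)
    qed
    also have "\<dots> \<le> C * \<epsilon>" using t C0 by (intro mult_left_mono) (auto simp: J_def)
    finally show ?thesis using that(1) by simp
  qed
  have Pz: "dist z (P x t) \<le> M * \<epsilon>" if "t \<in> J" for x t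
  proof -
    have "((\<lambda>t. P x t - z) has_vector_derivative F (x s)) (at s within J)" if "s \<in> J" for s
      using has_vector_derivative_diff[OF P'[OF that] has_vector_derivative_const, of x z] by simp
    then show ?thesis
      using mv[of "\<lambda>t. P x t - z" "\<lambda>s. F (x s)" M t] that P0 M
      by (simp add: dist_norm norm_minus_commute)
  qed
  have PP: "dist (P x t) (P y t) \<le> 1 / 2 * dist x y" if "t \<in> J" for x y t
  proof -
    have "norm (P x t - P y t) \<le> (L * dist x y) * \<epsilon>"
    proof (rule mv[of "\<lambda>t. P x t - P y t" "\<lambda>s. F (x s) - F (y s)"])
      fix s assume s: "s \<in> J"
      show "((\<lambda>t. P x t - P y t) has_vector_derivative F (x s) - F (y s)) (at s within J)"
        by (intro has_vector_derivative_diff P' s)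
      have "norm (F (x s) - F (y s)) \<le> L * dist (x s) (y s)"
        using lipschitz_onD[OF F, of "x s" "y s"] by (simp add: dist_norm)
      also have "\<dots> \<le> L * dist x y" using L0 dist_bounded by (intro mult_left_mono)
      finally show "norm (F (x s) - F (y s)) \<le> L * dist x y" .
    qed (use that P0 in auto)
    also have "\<dots> = (L * \<epsilon>) * dist x y" by simp
    also have "\<dots> \<le> 1 / 2 * dist x y" using \<epsilon> by (intro mult_right_mono) auto
    finally show ?thesis by (simp add: dist_norm)
  qed
  \<comment> \<open>The Banach space consists of functions on the whole line, so the values at the endpoints are
    continued as constants.\<close>
  define c where "c = clamp (-\<epsilon>) \<epsilon>"
  have cJ: "c t \<in> J" for t using clamp_in_interval[of "-\<epsilon>" \<epsilon> t] \<epsilon> by (auto simp: c_def J_def)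
  have cid: "c t = t" if "t \<in> J" for t using that by (auto simp: c_def J_def)
  define G where "G = (\<lambda>x. Bcontfun (\<lambda>t. P x (c t)))"
  have G: "apply_bcontfun (G x) t = P x (c t)" for x t
  proof -
    have "continuous_on J (P x)"
      using P' has_vector_derivative_continuous continuous_on_eq_continuous_within by blast
    then have "continuous_on UNIV (\<lambda>t. P x (c t))"
      unfolding c_def J_def by (intro clamp_continuous_on) auto
    moreover have "norm (P x (c t)) \<le> norm z + M * \<epsilon>" for t
      using Pz[OF cJ, of x t] norm_triangle_sub[of "P x (c t)" z] by (simp add: dist_norm norm_minus_commute)
    ultimately have "(\<lambda>t. P x (c t)) \<in> bcontfun" by (rule bcontfun_normI)
    then show ?thesis by (simp add: G_def Bcontfun_inverse)
  qed
  have "\<exists>!x. G x = x"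
  proof (rule banach_fix_type[of "1/2"])
    show "\<forall>x y. dist (G x) (G y) \<le> 1 / 2 * dist x y"
      by (intro allI dist_bound) (simp only: G PP[OF cJ])
  qed auto
  then obtain x where x: "G x = x" by blast
  have xP: "apply_bcontfun x t = P x t" if "t \<in> J" for t using G[of x t] x cid[OF that] by simp
  show ?thesis
  proof (intro exI[of _ "P x"] conjI ballI)
    fix t :: real assume "t \<in> ball 0 \<epsilon>"
    then have t: "t \<in> J" "t \<in> {-\<epsilon><..<\<epsilon>}" by (auto simp: J_def)
    have "(P x has_vector_derivative F (P x t)) (at t within J)" using P'[OF t(1), of x] xP[OF t(1)] by simp
    moreover have "at t within J = at t"
      using t by (intro at_within_interior) (auto simp: J_def)
    ultimately show "(P x has_vector_derivative F (P x t)) (at t)" by simp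
    show "dist z (P x t) \<le> M * \<epsilon>" by (rule Pz[OF t(1)])
  qed (rule P0)
qed

text \<open>
  The existence time and the neighbourhood of initial values are uniform near \<open>p\<close>. The uniformity is
  what allows solutions to be continued and makes the flow continuous in both variables.
\<close>

lemma ode_local_flow:
  fixes f :: "'a::euclidean_space \<Rightarrow> 'a"
  assumes f: "lipschitz_near p f" and S: "open S" "p \<in> S"
  obtains \<delta> \<epsilon> and w :: "'a \<Rightarrow> real \<Rightarrow> 'a" where "0 < \<delta>" "0 < \<epsilon>"
    "\<And>z. z \<in> ball p \<delta> \<Longrightarrow> w z 0 = z \<and> ode_solution f S (ball 0 \<epsilon>) (w z)"
    "\<And>z z' s. z \<in> ball p \<delta> \<Longrightarrow> z' \<in> ball p \<delta> \<Longrightarrow> s \<in> ball 0 \<epsilon> \<Longrightarrow> dist (w z s) (w z' s) \<le> 2 * dist z z'"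
proof -
  obtain r1 L where r1: "0 < r1" and L1: "L-lipschitz_on (cball p r1) f"
    using f unfolding lipschitz_near_def by blast
  obtain r2 where r2: "0 < r2" "cball p r2 \<subseteq> S" using S open_contains_cball by blast
  define r where "r = min r1 r2"
  let ?K = "cball p r"
  have r: "0 < r" and KS: "?K \<subseteq> S" using r1 r2 by (auto simp: r_def)
  have L: "L-lipschitz_on ?K f" by (rule lipschitz_on_subset[OF L1]) (auto simp: r_def)
  have L0: "0 \<le> L" using L lipschitz_on_nonneg by blast
  have "bounded (f ` ?K)"
    using L lipschitz_on_continuous_on by (intro compact_imp_bounded compact_continuous_image) auto
  then obtain M where M: "0 < M" "\<And>z. z \<in> ?K \<Longrightarrow> norm (f z) \<le> M" by (auto simp: bounded_pos)
  \<comment> \<open>The projection to a convex set does not increase distances, so \<open>F\<close> extends \<open>f\<close> from the ball to a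
    bounded Lipschitz map on the whole space.\<close>
  define F where "F = (\<lambda>z. f (closest_point ?K z))"
  have K: "convex ?K" "closed ?K" "?K \<noteq> {}" using r by auto
  have cp: "closest_point ?K z \<in> ?K" for z using closest_point_in_set K by blast
  have F: "L-lipschitz_on UNIV F"
    unfolding F_def
  proof (rule lipschitz_onI[OF _ L0])
    fix x y
    have "dist (f (closest_point ?K x)) (f (closest_point ?K y)) \<le> L * dist (closest_point ?K x) (closest_point ?K y)"
      by (rule lipschitz_onD[OF L cp cp])
    also have "\<dots> \<le> L * dist x y" using L0 closest_point_lipschitz[OF K] by (intro mult_left_mono)
    finally show "dist (f (closest_point ?K x)) (f (closest_point ?K y)) \<le> L * dist x y" .
  qed
  \<comment> \<open>The first bound keeps a solution that starts in the half-size ball inside \<open>?K\<close>, where \<open>F\<close> is \<open>f\<close>;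
    the second makes the iteration a contraction.\<close>
  define \<epsilon> where "\<epsilon> = min (r / (2 * M)) (1 / (2 * (L + 1)))"
  have \<epsilon>: "0 < \<epsilon>" using r M L0 by (auto simp: \<epsilon>_def)
  have "L * \<epsilon> \<le> (L + 1) * (1 / (2 * (L + 1)))" using L0 \<epsilon> by (intro mult_mono) (auto simp: \<epsilon>_def)
  also have "\<dots> = 1 / 2" using L0 by (simp add: divide_simps)
  finally have L\<epsilon>: "L * \<epsilon> \<le> 1 / 2" .
  have "M * \<epsilon> \<le> M * (r / (2 * M))" using M by (intro mult_left_mono) (auto simp: \<epsilon>_def)
  then have M\<epsilon>: "M * \<epsilon> \<le> r / 2" using M by simp
  have "\<forall>z. \<exists>w. w 0 = z \<and> (\<forall>t\<in>ball 0 \<epsilon>. (w has_vector_derivative F (w t)) (at t) \<and> dist z (w t) \<le> M * \<epsilon>)"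
    using picard_lindelof_bounded[OF F _ \<epsilon> L\<epsilon>, of M] M(2) cp by (auto simp: F_def)
  then obtain w where w: "\<And>z. w z 0 = z"
      "\<And>z t. t \<in> ball 0 \<epsilon> \<Longrightarrow> (w z has_vector_derivative F (w z t)) (at t)"
      "\<And>z t. t \<in> ball 0 \<epsilon> \<Longrightarrow> dist z (w z t) \<le> M * \<epsilon>"
    by metis
  have wK: "w z t \<in> ?K" if "z \<in> ball p (r/2)" "t \<in> ball 0 \<epsilon>" for z t
    using w(3)[OF that(2), of z] that(1) M\<epsilon> dist_triangle[of p "w z t" z] by auto
  have wf: "(w z has_vector_derivative f (w z t)) (at t)" if "z \<in> ball p (r/2)" "t \<in> ball 0 \<epsilon>" for z t
    using w(2)[OF that(2), of z] wK[OF that] by (simp add: F_def closest_point_self)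
  show thesis
  proof (rule that[of "r/2" \<epsilon> w])
    fix z assume z: "z \<in> ball p (r/2)"
    show "w z 0 = z \<and> ode_solution f S (ball 0 \<epsilon>) (w z)"
      using w(1) wf[OF z] wK[OF z] KS unfolding ode_solution_def by (auto simp: subset_iff)
  next
    fix z z' and s :: real assume z: "z \<in> ball p (r/2)" "z' \<in> ball p (r/2)" "s \<in> ball 0 \<epsilon>"
    show "dist (w z s) (w z' s) \<le> 2 * dist z z'"
      using ode_solution_dist_le[OF wf[OF z(1)] wK[OF z(1)] wf[OF z(2)] wK[OF z(2)] L L\<epsilon> z(3)]
      by (simp add: w(1))
  qed (use r \<epsilon> in auto)
qed

text \<open>
  In contrast to the plane, two connected subsets of the line have a connected intersection; hence
  two solutions with different time domains can be compared on the common part.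
\<close>

lemma connected_Int_real: "connected (A \<inter> B)" if "connected A" "connected B" for A B :: "real set"
  using that is_interval_Int by (simp flip: is_interval_connected_1)

lemma ode_solution_unique_Int:
  assumes f: "\<forall>p\<in>S. lipschitz_near p f"
    and x: "ode_solution f S I x" and y: "ode_solution f S J y"
    and "t0 \<in> I" "t0 \<in> J" "x t0 = y t0" and "t \<in> I" "t \<in> J"
  shows "x t = y t"
proof (rule ode_solution_unique[OF f])
  have *: "open (I \<inter> J)" "connected (I \<inter> J)"
    using ode_solutionD[OF x] ode_solutionD[OF y] by (auto intro: connected_Int_real)
  show "ode_solution f S (I \<inter> J) x" by (rule ode_solution_subset[OF x *]) auto
  show "ode_solution f S (I \<inter> J) y" by (rule ode_solution_subset[OF y *]) auto
qed (use assms in auto)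

lemma ode_local_existence:
  fixes f :: "'a::euclidean_space \<Rightarrow> 'a"
  assumes "lipschitz_near p f" "open S" "p \<in> S"
  obtains \<delta> \<epsilon> where "0 < \<delta>" "0 < \<epsilon>"
    "\<And>z t0. z \<in> ball p \<delta> \<Longrightarrow> \<exists>w. ode_solution f S (ball t0 \<epsilon>) w \<and> w t0 = z"
proof -
  obtain \<delta> \<epsilon> and w :: "'a \<Rightarrow> real \<Rightarrow> 'a" where *: "0 < \<delta>" "0 < \<epsilon>"
    "\<And>z. z \<in> ball p \<delta> \<Longrightarrow> w z 0 = z \<and> ode_solution f S (ball 0 \<epsilon>) (w z)"
    using ode_local_flow[OF assms] by metis
  show thesis
  proof (rule that[OF *(1,2)])
    fix z and t0 :: real assume z: "z \<in> ball p \<delta>"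
    have "(+) (- t0) -` ball 0 \<epsilon> = ball t0 \<epsilon>" by (auto simp: dist_real_def)
    then have "ode_solution f S (ball t0 \<epsilon>) (\<lambda>t. w z (- t0 + t))"
      using ode_solution_shift[of f S "ball 0 \<epsilon>" "w z" "- t0"] *(3)[OF z] by simp
    then show "\<exists>w. ode_solution f S (ball t0 \<epsilon>) w \<and> w t0 = z"
      using *(3)[OF z] by (intro exI[of _ "\<lambda>t. w z (- t0 + t)"]) simp
  qed
qed

text \<open>
  Any two solutions through the same initial value agree where both are defined, so all of them
  glue to one solution on the union of their domains. The set \<open>J\<close> restricts the admissible times.
\<close>

lemma ode_maximal_solution:
  fixes f :: "'a::euclidean_space \<Rightarrow> 'a"
  assumes f: "\<forall>p\<in>S. lipschitz_near p f" and S: "open S" "z0 \<in> S"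
    and J: "open J" "t0 \<in> J"
  obtains I w where "ode_solution f S I w" "I \<subseteq> J" "t0 \<in> I" "w t0 = z0"
    "\<forall>I' w'. ode_solution f S I' w' \<and> I' \<subseteq> J \<and> t0 \<in> I' \<and> w' t0 = z0 \<longrightarrow>
      I' \<subseteq> I \<and> (\<forall>t\<in>I'. w' t = w t)"
proof -
  define \<S> where "\<S> = {(I, w). ode_solution f S I w \<and> I \<subseteq> J \<and> t0 \<in> I \<and> w t0 = z0}"
  have agree: "w1 t = w2 t" if "(I1, w1) \<in> \<S>" "(I2, w2) \<in> \<S>" "t \<in> I1" "t \<in> I2" for I1 w1 I2 w2 t
    using ode_solution_unique_Int[OF f, of I1 w1 I2 w2 t0 t] that by (auto simp: \<S>_def)
  define I where "I = (\<Union>(I', w')\<in>\<S>. I')"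
  define w where "w = (\<lambda>t. SOME y. \<exists>(I', w')\<in>\<S>. t \<in> I' \<and> y = w' t)"
  have w: "w t = w' t" if "(I', w') \<in> \<S>" "t \<in> I'" for I' w' t
  proof -
    have "\<exists>(I', w')\<in>\<S>. t \<in> I' \<and> w t = w' t"
      unfolding w_def by (rule someI[of _ "w' t"]) (use that in auto)
    then show ?thesis using agree[OF _ that(1) _ that(2)] by auto
  qed
  have "\<exists>I' w'. (I', w') \<in> \<S>"
  proof -
    obtain \<epsilon> where e: "0 < \<epsilon>" "\<And>t0. \<exists>w. ode_solution f S (ball t0 \<epsilon>) w \<and> w t0 = z0"
      using ode_local_existence[OF bspec[OF f S(2)] S] by (metis centre_in_ball)
    obtain r where r: "0 < r" "ball t0 r \<subseteq> J" using J open_contains_ball by blast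
    obtain v where v: "ode_solution f S (ball t0 \<epsilon>) v" "v t0 = z0" using e by blast
    have "ode_solution f S (ball t0 (min \<epsilon> r)) v"
      by (rule ode_solution_subset[OF v(1)]) auto
    then show ?thesis using v r e by (intro exI[of _ "ball t0 (min \<epsilon> r)"] exI[of _ v]) (auto simp: \<S>_def)
  qed
  then have t0: "t0 \<in> I" by (auto simp: I_def \<S>_def)
  show thesis
  proof (rule that[of I w])
    show "ode_solution f S I w"
      unfolding ode_solution_def
    proof (intro conjI ballI)
      show "open I" unfolding I_def by (rule open_UN) (auto simp: \<S>_def dest: ode_solutionD)
      show "connected I" unfolding I_def
        by (rule connected_Union) (auto simp: \<S>_def dest: ode_solutionD)
      fix t assume "t \<in> I"
      then obtain I' w' where *: "(I', w') \<in> \<S>" "t \<in> I'" by (auto simp: I_def)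
      then have s: "ode_solution f S I' w'" by (simp add: \<S>_def)
      show "w t \<in> S" using w[OF *] ode_solutionD(3)[OF s *(2)] by simp
      have "(w has_vector_derivative f (w' t)) (at t)"
        by (rule has_vector_derivative_transform_within_open[OF ode_solutionD(4)[OF s *(2)] ode_solutionD(1)[OF s] *(2)])
          (use w[OF *(1)] in auto)
      then show "(w has_vector_derivative f (w t)) (at t)" using w[OF *] by simp
    qed
    show "I \<subseteq> J" by (auto simp: I_def \<S>_def)
    show "t0 \<in> I" by (rule t0)
    then obtain I' w' where "(I', w') \<in> \<S>" "t0 \<in> I'" by (auto simp: I_def)
    then show "w t0 = z0" using w by (auto simp: \<S>_def)
    have "I' \<subseteq> I \<and> (\<forall>t\<in>I'. w' t = w t)" if "(I', w') \<in> \<S>" for I' w'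
      using w[OF that] that by (auto simp: I_def)
    then show "\<forall>I' w'. ode_solution f S I' w' \<and> I' \<subseteq> J \<and> t0 \<in> I' \<and> w' t0 = z0 \<longrightarrow>
      I' \<subseteq> I \<and> (\<forall>t\<in>I'. w' t = w t)"
      unfolding \<S>_def by (intro allI impI) blast
  qed
qed

text \<open>
  If the solution is confined to a compact subset of \<open>S\<close> during bounded time, it cannot stop. At an
  endpoint of its domain its values accumulate at some point of \<open>S\<close>, and the uniform existence time
  near that point carries the solution past the endpoint. Therefore the maximal domain is closed
  as well as open.
\<close>

lemma ode_global_solution:
  fixes f :: "'a::euclidean_space \<Rightarrow> 'a"
  assumes f: "\<forall>p\<in>S. lipschitz_near p f" and S: "open S" "z0 \<in> S"
    and K: "\<And>R. \<exists>K. compact K \<and> K \<subseteq> S \<and>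
      (\<forall>I w. ode_solution f S I w \<longrightarrow> 0 \<in> I \<longrightarrow> w 0 = z0 \<longrightarrow> w ` (I \<inter> cball 0 R) \<subseteq> K)"
  obtains w where "ode_solution f S UNIV w" "w 0 = z0"
proof -
  obtain I w where sol: "ode_solution f S I w" and I: "0 \<in> I" "w 0 = z0"
    and max: "\<forall>I' w'. ode_solution f S I' w' \<and> I' \<subseteq> UNIV \<and> 0 \<in> I' \<and> w' 0 = z0 \<longrightarrow>
      I' \<subseteq> I \<and> (\<forall>t\<in>I'. w' t = w t)"
    by (rule ode_maximal_solution[OF f S open_UNIV UNIV_I, of 0]) (rule that)
  have "closed I"
    unfolding closed_sequential_limits
  proof (intro allI impI)
    fix e l assume "(\<forall>n. e n \<in> I) \<and> e \<longlonglongrightarrow> l"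
    then have eI: "\<And>n. e n \<in> I" and el: "e \<longlonglongrightarrow> l" by auto
    obtain R where R: "\<And>n. norm (e n) \<le> R"
      using convergent_imp_bounded[OF el] by (auto simp: bounded_iff)
    obtain K' where K': "compact K' \<and> K' \<subseteq> S \<and>
        (\<forall>I w. ode_solution f S I w \<longrightarrow> 0 \<in> I \<longrightarrow> w 0 = z0 \<longrightarrow> w ` (I \<inter> cball 0 R) \<subseteq> K')"
      using K[of R] ..
    then have K': "compact K'" "K' \<subseteq> S" "w ` (I \<inter> cball 0 R) \<subseteq> K'"
      using sol I by simp_all
    have "\<forall>n. w (e n) \<in> K'" using K'(3) eI R by auto
    then obtain p r where p: "p \<in> K'" "strict_mono r" "((\<lambda>n. w (e n)) \<circ> r) \<longlonglongrightarrow> p"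
      using K'(1) unfolding compact_def by metis
    have pS: "p \<in> S" using p(1) K'(2) by blast
    obtain \<delta> \<epsilon> where d: "0 < \<delta>" "0 < \<epsilon>"
      "\<And>z t0. z \<in> ball p \<delta> \<Longrightarrow> \<exists>w. ode_solution f S (ball t0 \<epsilon>) w \<and> w t0 = z"
      by (rule ode_local_existence[OF bspec[OF f pS] S(1) pS]) (rule that)
    have "\<forall>\<^sub>F n in sequentially. dist (((\<lambda>n. w (e n)) \<circ> r) n) p < \<delta>"
      using p(3) d(1) by (rule tendstoD)
    moreover have "\<forall>\<^sub>F n in sequentially. dist ((e \<circ> r) n) l < \<epsilon>"
      using LIMSEQ_subseq_LIMSEQ[OF el p(2)] d(2) by (rule tendstoD)
    ultimately have "\<forall>\<^sub>F n in sequentially. dist (w (e (r n))) p < \<delta> \<and> dist (e (r n)) l < \<epsilon>"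
      by eventually_elim auto
    then obtain n where n: "dist (w (e (r n))) p < \<delta>" "dist (e (r n)) l < \<epsilon>"
      using eventually_happens trivial_limit_sequentially by blast
    define t1 where "t1 = e (r n)"
    have t1: "t1 \<in> I" "l \<in> ball t1 \<epsilon>" "t1 \<in> ball t1 \<epsilon>" using eI n d by (auto simp: t1_def)
    \<comment> \<open>Restart at the time \<open>t1\<close>, whose distance to \<open>l\<close> is less than the uniform existence time.\<close>
    obtain v where v: "ode_solution f S (ball t1 \<epsilon>) v" "v t1 = w t1"
      using d(3)[of "w t1" t1] n by (auto simp: t1_def dist_commute)
    have "w t1 \<in> S" by (rule ode_solutionD(3)[OF sol t1(1)])
    then obtain I1 w1 where I1: "ode_solution f S I1 w1" 
      and max1: "\<forall>I' w'. ode_solution f S I' w' \<and> I' \<subseteq> UNIV \<and> t1 \<in> I' \<and> w' t1 = w t1 \<longrightarrow>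
      I' \<subseteq> I1 \<and> (\<forall>t\<in>I'. w' t = w1 t)"
      by (rule ode_maximal_solution[OF f S(1) _ open_UNIV UNIV_I, of "w t1" t1]) (rule that)
    have "I \<subseteq> I1 \<and> (\<forall>t\<in>I. w t = w1 t)" using max1[rule_format, of I w] sol t1(1) by simp
    then have "I1 \<subseteq> I" using max[rule_format, of I1 w1] I1 I by auto
    moreover have "ball t1 \<epsilon> \<subseteq> I1" using max1[rule_format, of "ball t1 \<epsilon>" v] v t1(3) by blast
    ultimately show "l \<in> I" using t1 by auto
  qed
  with ode_solutionD(1)[OF sol] I have "I = UNIV" using clopen[of I] by auto
  with that sol I show thesis by blast
qed

lemma isCont_Lipschitz_family:
  fixes \<phi> :: "'a::metric_space \<Rightarrow> 'b::metric_space \<Rightarrow> 'c::metric_space"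
  assumes lip: "\<And>z z' s. z \<in> N \<Longrightarrow> z' \<in> N \<Longrightarrow> s \<in> T \<Longrightarrow> dist (\<phi> z s) (\<phi> z' s) \<le> C * dist z z'"
    and open_sets: "open N" "open T" and zs: "z \<in> N" "s \<in> T" and cont: "isCont (\<phi> z) s"
  shows "isCont (\<lambda>x. \<phi> (fst x) (snd x)) (z, s)"
  unfolding isCont_def
proof (rule metric_tendsto_imp_tendsto)
  let ?g = "\<lambda>x. C * dist (fst x) z + dist (\<phi> z (snd x)) (\<phi> z s)"
  have "((\<lambda>x. \<phi> z (snd x)) \<longlongrightarrow> \<phi> z s) (at (z, s))"
    by (rule isCont_tendsto_compose[OF cont]) (auto intro!: tendsto_eq_intros)
  then have "(?g \<longlongrightarrow> C * dist z z + dist (\<phi> z s) (\<phi> z s)) (at (z, s))"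
    by (intro tendsto_intros) (auto intro!: tendsto_eq_intros)
  then show "(?g \<longlongrightarrow> 0) (at (z, s))" by simp
  have "\<forall>\<^sub>F x in at (z, s). x \<in> N \<times> T"
    using open_sets zs by (intro eventually_at_in_open') (auto intro: open_Times)
  then show "\<forall>\<^sub>F x in at (z, s). dist (\<phi> (fst x) (snd x)) (\<phi> (fst (z, s)) (snd (z, s))) \<le> dist (?g x) 0"
  proof eventually_elim
    case (elim x)
    have "dist (\<phi> (fst x) (snd x)) (\<phi> z s) \<le> ?g x"
      using lip[of "fst x" z "snd x"] elim zs dist_triangle[of "\<phi> (fst x) (snd x)" "\<phi> z s" "\<phi> z (snd x)"]
      by auto
    then show ?case by simp
  qed
qed

text \<open>
  A flow whose solutions are parametrised by a function \<open>\<tau>\<close> on the phase space, so that \<open>W z t\<close> is the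
  point on the orbit of \<open>z\<close> at which \<open>\<tau>\<close> has the value \<open>t\<close>. For times close to \<open>\<tau> z\<close> continuity is
  inherited from the local flow. Since \<open>W z t = W (W z s) t\<close>, continuity at one time \<open>s\<close> propagates
  to all times \<open>t\<close> near \<open>s\<close>, and connectedness of the time interval takes it to every time.
\<close>

lemma ode_flow_isCont:
  fixes W :: "'a::euclidean_space \<Rightarrow> real \<Rightarrow> 'a" and \<tau> :: "'a \<Rightarrow> real"
  assumes f: "\<forall>p\<in>S. lipschitz_near p f" and S: "open S"
    and W: "\<And>z. z \<in> S \<Longrightarrow> ode_solution f S T (W z)" "\<And>z. z \<in> S \<Longrightarrow> W z (\<tau> z) = z"
    and \<tau>: "\<And>z. z \<in> S \<Longrightarrow> \<tau> z \<in> T" "\<And>z t. z \<in> S \<Longrightarrow> t \<in> T \<Longrightarrow> \<tau> (W z t) = t"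
    and cont: "continuous_on S \<tau>" and p: "p \<in> S" "t \<in> T"
  shows "isCont (\<lambda>x. W (fst x) (snd x)) (p, t)"
proof -
  let ?W = "\<lambda>x. W (fst x) (snd x)"
  have T: "open T" "connected T" using ode_solutionD[OF W(1)[OF p(1)]] by auto
  have WS: "W z t \<in> S" if "z \<in> S" "t \<in> T" for z t using ode_solutionD(3)[OF W(1)] that by auto
  have \<tau>_cont: "isCont \<tau> z" if "z \<in> S" for z
    using cont S that by (simp add: continuous_on_eq_continuous_at)
  have WW: "W (W z s) t = W z t" if "z \<in> S" "s \<in> T" "t \<in> T" for z s t
    using ode_solution_unique[OF f W(1)[OF WS[OF that(1,2)]] W(1)[OF that(1)] that(2) _ that(3)]
      W(2)[OF WS[OF that(1,2)]] \<tau>(2)[OF that(1,2)] by simp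
  have local: "\<exists>N \<eta>. open N \<and> q \<in> N \<and> N \<subseteq> S \<and> 0 < \<eta> \<and> (\<forall>z\<in>N. \<forall>t\<in>T \<inter> ball (\<tau> q) \<eta>. isCont ?W (z, t))"
    if q: "q \<in> S" for q
  proof -
    obtain \<delta> \<epsilon> and \<phi> :: "'a \<Rightarrow> real \<Rightarrow> 'a" where d: "0 < \<delta>" "0 < \<epsilon>"
      and \<phi>: "\<And>z. z \<in> ball q \<delta> \<Longrightarrow> \<phi> z 0 = z \<and> ode_solution f S (ball 0 \<epsilon>) (\<phi> z)"
      and lip: "\<And>z z' s. z \<in> ball q \<delta> \<Longrightarrow> z' \<in> ball q \<delta> \<Longrightarrow> s \<in> ball 0 \<epsilon> \<Longrightarrow>
        dist (\<phi> z s) (\<phi> z' s) \<le> 2 * dist z z'"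
      by (rule ode_local_flow[OF bspec[OF f q] S q]) blast
    \<comment> \<open>The halves ensure \<open>\<bar>t - \<tau> z\<bar> < \<epsilon>\<close> on \<open>N \<times> T'\<close>.\<close>
    define N where "N = ball q \<delta> \<inter> (S \<inter> \<tau> -` ball (\<tau> q) (\<epsilon>/2))"
    define T' where "T' = T \<inter> ball (\<tau> q) (\<epsilon>/2)"
    have N: "open N" unfolding N_def using cont S by (intro open_Int continuous_open_preimage) auto
    have T': "open T'" using T by (auto simp: T'_def)
    have s: "t - \<tau> z \<in> ball 0 \<epsilon>" if "z \<in> N" "t \<in> T'" for z t
      using that by (auto simp: N_def T'_def dist_real_def abs_if split: if_splits)
    have eq: "W z t = \<phi> z (t - \<tau> z)" if zt: "z \<in> N" "t \<in> T'" for z t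
    proof -
      have z: "z \<in> S" "z \<in> ball q \<delta>" using zt by (auto simp: N_def)
      have "(\<lambda>s. W z (\<tau> z + s)) (t - \<tau> z) = \<phi> z (t - \<tau> z)"
        by (rule ode_solution_unique_Int[OF f ode_solution_shift[OF W(1)[OF z(1)]] conjunct2[OF \<phi>[OF z(2)]], of 0])
          (use s[OF zt] zt W(2)[OF z(1)] \<tau>(1)[OF z(1)] \<phi>[OF z(2)] d in \<open>auto simp: T'_def\<close>)
      then show ?thesis by simp
    qed
    have "isCont ?W (z, t)" if zt: "z \<in> N" "t \<in> T'" for z t
    proof -
      have z: "z \<in> S" "z \<in> ball q \<delta>" using zt by (auto simp: N_def)
      have "isCont (\<lambda>x. \<phi> (fst x) (snd x)) (z, t - \<tau> z)"
        by (rule isCont_Lipschitz_family[OF lip _ _ z(2) s[OF zt]])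
          (use ode_solutionD(5)[OF conjunct2[OF \<phi>[OF z(2)]] s[OF zt]] in auto)
      moreover have "isCont (\<lambda>x. (fst x, snd x - \<tau> (fst x))) (z, t)"
        using isCont_o2[of "(z, t)" fst \<tau>] \<tau>_cont[OF z(1)] by (intro continuous_intros) auto
      ultimately have "isCont (\<lambda>x. \<phi> (fst x) (snd x - \<tau> (fst x))) (z, t)"
        using isCont_o2[of "(z, t)" "\<lambda>x. (fst x, snd x - \<tau> (fst x))" "\<lambda>x. \<phi> (fst x) (snd x)"] by simp
      moreover have "\<forall>\<^sub>F x in nhds (z, t). ?W x = \<phi> (fst x) (snd x - \<tau> (fst x))"
      proof (rule eventually_mono[OF eventually_nhds_in_open])
        show "open (N \<times> T')" "(z, t) \<in> N \<times> T'" using N T' zt by (auto intro: open_Times)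
      qed (auto simp: eq)
      ultimately show ?thesis by (simp only: isCont_cong)
    qed
    then show ?thesis
      using N q d by (intro exI[of _ N] exI[of _ "\<epsilon>/2"]) (auto simp: N_def T'_def)
  qed
  define E where "E = {t. isCont ?W (p, t)}"
  have "\<tau> p \<in> E \<longleftrightarrow> t \<in> E"
  proof (rule connected_equivalence_relation[OF T(2) \<tau>(1)[OF p(1)] p(2), where R = "\<lambda>a b. a \<in> E \<longleftrightarrow> b \<in> E"])
    fix t1 assume t1: "t1 \<in> T"
    define q where "q = W p t1"
    have q: "q \<in> S" "\<tau> q = t1" using WS[OF p(1) t1] \<tau>(2)[OF p(1) t1] by (auto simp: q_def)
    obtain N \<eta> where N: "open N" "q \<in> N" "N \<subseteq> S" "0 < \<eta>"
      "\<And>z t. z \<in> N \<Longrightarrow> t \<in> T \<inter> ball t1 \<eta> \<Longrightarrow> isCont ?W (z, t)"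
      using local[OF q(1)] unfolding q(2) by blast
    \<comment> \<open>For times \<open>a\<close>, \<open>b\<close> in \<open>U\<close> the point \<open>W p a\<close> is so close to \<open>q\<close> that the local statement applies
    to the orbit restarted there.\<close>
    define U where "U = (T \<inter> W p -` N) \<inter> ball t1 \<eta>"
    have "open U"
      unfolding U_def using ode_solutionD(6)[OF W(1)[OF p(1)]] T N
      by (intro open_Int continuous_open_preimage) auto
    moreover have "t1 \<in> U" using t1 N by (auto simp: U_def q_def)
    moreover have "b \<in> E" if ab: "a \<in> U" "b \<in> U" "a \<in> E" for a b
    proof -
      have a: "a \<in> T" "W p a \<in> N" and b: "b \<in> T" "b \<in> T \<inter> ball t1 \<eta>" using ab by (auto simp: U_def)
      have "isCont (\<lambda>x. W (fst x) a) (p, b)"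
        using isCont_o2[of "(p, b)" "\<lambda>x. (fst x, a)" ?W] ab(3) by (simp add: E_def)
      then have "isCont (\<lambda>x. (W (fst x) a, snd x)) (p, b)" by (intro continuous_intros) auto
      then have "isCont (\<lambda>x. W (W (fst x) a) (snd x)) (p, b)"
        using isCont_o2[of "(p, b)" "\<lambda>x. (W (fst x) a, snd x)" ?W] N(5)[OF a(2) b(2)] by simp
      moreover have "\<forall>\<^sub>F x in nhds (p, b). ?W x = W (W (fst x) a) (snd x)"
      proof (rule eventually_mono[OF eventually_nhds_in_open])
        show "open (S \<times> T)" "(p, b) \<in> S \<times> T" using S T p b by (auto intro: open_Times)
      qed (use a WW in auto)
      ultimately show ?thesis unfolding E_def by (simp only: mem_Collect_eq isCont_cong)
    qed
    moreover have "U \<subseteq> T" unfolding U_def by blast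
    ultimately show "\<exists>U. openin (top_of_set T) U \<and> t1 \<in> U \<and> (\<forall>x\<in>U. (t1 \<in> E) = (x \<in> E))"
      by (intro exI[of _ U] conjI ballI iffI open_subset) blast+
  qed blast+
  moreover have "\<tau> p \<in> E" using local[OF p(1)] \<tau>(1)[OF p(1)] by (auto simp: E_def)
  ultimately show ?thesis by (simp add: E_def)
qed

section \<open>The hyperbolic derivative and its gradient\<close>

text \<open>
  Composing with disc automorphisms that move \<open>z\<close> and \<open>\<phi> z\<close> to 0 turns the hyperbolic derivative
  into an ordinary derivative at 0, to which the Schwarz lemma applies.
\<close>

lemma Schwarz_Pick:
  assumes hol: "\<phi> holomorphic_on ball 0 1" and self: "\<phi> ` ball 0 1 \<subseteq> ball 0 1"
    and z: "z \<in> ball 0 1"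
  shows "cmod (hyp_deriv \<phi> z) \<le> 1"
proof -
  let ?M = "Moebius_function 0"
  define w where "w = \<phi> z"
  have w: "cmod w < 1" using subsetD[OF self imageI[OF z]] by (simp add: w_def)
  have z1: "cmod z < 1" "cmod (- z) < 1" using z by auto
  define g where "g = (\<lambda>\<zeta>. ?M w (\<phi> (?M (- z) \<zeta>)))"
  have M1: "cmod (?M (- z) \<zeta>) < 1" if "cmod \<zeta> < 1" for \<zeta>
    using Moebius_function_norm_lt_1[OF z1(2) that] .
  have "(\<phi> \<circ> ?M (- z)) holomorphic_on ball 0 1"
    using M1 by (intro holomorphic_on_compose_gen[OF Moebius_function_holomorphic[OF z1(2)] hol]) auto
  then have "(?M w \<circ> (\<phi> \<circ> ?M (- z))) holomorphic_on ball 0 1"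
    using M1 self by (intro holomorphic_on_compose_gen[OF _ Moebius_function_holomorphic[OF w]]) auto
  then have "g holomorphic_on ball 0 1" by (simp add: g_def o_def)
  moreover have "g 0 = 0" by (simp add: g_def Moebius_function_of_zero Moebius_function_eq_zero w_def)
  moreover have "cmod (g \<zeta>) < 1" if "cmod \<zeta> < 1" for \<zeta>
    using Moebius_function_norm_lt_1[OF w, of "\<phi> (?M (- z) \<zeta>)" 0] M1[OF that] subsetD[OF self imageI, of "?M (- z) \<zeta>"] by (simp add: g_def)
  ultimately have "cmod (deriv g 0) \<le> 1"
    using Schwarz_Lemma(2)[of g 0] by simp
  moreover have "deriv g 0 = hyp_deriv \<phi> z"
  proof (rule DERIV_imp_deriv)
    have N: "1 - cnj w * w = of_real (1 - (cmod w)\<^sup>2)" "1 - cnj z * z = of_real (1 - (cmod z)\<^sup>2)"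
      using complex_norm_square[of w] complex_norm_square[of z] by (simp_all add: mult.commute)
    have wn: "1 - (cmod w)\<^sup>2 \<noteq> 0" using w by (simp add: abs_square_eq_1)
    have a: "(?M (- z) has_field_derivative of_real (1 - (cmod z)\<^sup>2)) (at 0)"
      unfolding Moebius_function_simple N(2)[symmetric]
      by (auto intro!: derivative_eq_intros simp: algebra_simps)
    have b: "(\<phi> has_field_derivative deriv \<phi> z) (at (?M (- z) 0))"
      using holomorphic_derivI[OF hol _ z] by (simp add: Moebius_function_of_zero)
    have c: "(?M w has_field_derivative 1 / of_real (1 - (cmod w)\<^sup>2)) (at (\<phi> (?M (- z) 0)))"
    proof -
      have nz: "1 - cnj w * w \<noteq> 0" using wn unfolding N(1) of_real_eq_0_iff .
      have "(?M w has_field_derivative 1 / (1 - cnj w * w)) (at w)"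
        unfolding Moebius_function_simple using nz
        by (auto intro!: derivative_eq_intros simp: divide_simps power2_eq_square)
      then show ?thesis unfolding N(1) by (simp add: Moebius_function_of_zero w_def)
    qed
    have "(g has_field_derivative (1 / of_real (1 - (cmod w)\<^sup>2)) * (deriv \<phi> z * of_real (1 - (cmod z)\<^sup>2))) (at 0)"
      unfolding g_def by (rule DERIV_chain2[OF c DERIV_chain2[OF b a]])
    then show "(g has_field_derivative hyp_deriv \<phi> z) (at 0)"
      by (simp add: hyp_deriv_def w_def mult.commute)
  qed
  ultimately show ?thesis by simp
qed

lemma has_derivative_cmod_square:
  assumes "(g has_field_derivative g') (at z)"
  shows "((\<lambda>z. (cmod (g z))\<^sup>2) has_derivative (\<lambda>h. 2 * Re (cnj (g z) * g' * h))) (at z)"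
proof -
  have g: "(g has_derivative (\<lambda>h. g' * h)) (at z)"
    using assms by (simp add: has_field_derivative_def)
  have "((\<lambda>z. g z \<bullet> g z) has_derivative (\<lambda>h. g z \<bullet> (g' * h) + (g' * h) \<bullet> g z)) (at z)"
    by (rule has_derivative_inner[OF g g])
  moreover have "g z \<bullet> (g' * h) + (g' * h) \<bullet> g z = 2 * Re (cnj (g z) * g' * h)" for h
    by (simp add: inner_complex_def algebra_simps)
  ultimately show ?thesis by (simp add: power2_norm_eq_inner)
qed

text \<open>
  Self-maps of the disc for which the modulus of the hyperbolic derivative has neither zeros nor
  critical points; the gradient of its logarithm is computed in \<open>ln_u_has_derivative\<close>.
\<close>

locale noncritical_self_map =
  fixes \<phi> :: "complex \<Rightarrow> complex"
  assumes hol: "\<phi> holomorphic_on ball 0 1"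
    and self: "\<phi> ` ball 0 1 \<subseteq> ball 0 1"
    and deriv_ne: "\<And>z. z \<in> ball 0 1 \<Longrightarrow> deriv \<phi> z \<noteq> 0"
    and A_ne: "\<And>z. z \<in> ball 0 1 \<Longrightarrow> A_fun \<phi> z \<noteq> 0"
begin

abbreviation "u z \<equiv> cmod (hyp_deriv \<phi> z)"

lemma defect_pos:
  assumes "z \<in> ball 0 1"
  shows "0 < 1 - (cmod z)\<^sup>2" "0 < 1 - (cmod (\<phi> z))\<^sup>2"
  using assms subsetD[OF self imageI[OF assms]] by (auto simp: abs_square_less_1)

lemma u_eq: 
  assumes "z \<in> ball 0 1"
  shows "u z = (1 - (cmod z)\<^sup>2) * cmod (deriv \<phi> z) / (1 - (cmod (\<phi> z))\<^sup>2)"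
  using defect_pos[OF assms] unfolding hyp_deriv_def norm_divide norm_mult norm_of_real by simp

lemma u_pos: "z \<in> ball 0 1 \<Longrightarrow> 0 < u z"
  using defect_pos[of z] deriv_ne[of z] by (subst u_eq) auto

text \<open>
  The function \<open>A_fun \<phi>\<close> is the complex gradient of \<open>ln u\<close>, up to the factor \<open>1 - \<bar>z\<bar>\<^sup>2\<close>: differentiate
  \<open>ln u = ln (1 - \<bar>z\<bar>\<^sup>2) + ln \<bar>\<phi>' z\<bar> - ln (1 - \<bar>\<phi> z\<bar>\<^sup>2)\<close>.
\<close>

lemma ln_u_has_derivative:
  assumes z: "z \<in> ball 0 1"
  shows "((\<lambda>z. ln (u z)) has_derivative (\<lambda>h. 2 * Re (A_fun \<phi> z * h) / (1 - (cmod z)\<^sup>2))) (at z)"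
proof -
  note pos = defect_pos[OF z] and nz = deriv_ne[OF z]
  define N M where "N = 1 - (cmod z)\<^sup>2" and "M = 1 - (cmod (\<phi> z))\<^sup>2"
  let ?p = "deriv \<phi> z" and ?q = "deriv (deriv \<phi>) z"
  have d1: "(\<phi> has_field_derivative ?p) (at z)"
    using holomorphic_derivI[OF hol _ z] by simp
  have d2: "(deriv \<phi> has_field_derivative ?q) (at z)"
    using holomorphic_derivI[OF holomorphic_deriv[OF hol] _ z] by simp
  have d0: "((\<lambda>z. z) has_field_derivative 1) (at z)" by (rule DERIV_ident)
  define F where "F = (\<lambda>z. ln (1 - (cmod z)\<^sup>2) + 1 / 2 * ln ((cmod (deriv \<phi> z))\<^sup>2) - ln (1 - (cmod (\<phi> z))\<^sup>2))"
  have "(F has_derivative (\<lambda>h. (0 - 2 * Re (cnj z * 1 * h)) * inverse N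
      + 1 / 2 * (2 * Re (cnj ?p * ?q * h) * inverse ((cmod ?p)\<^sup>2))
      - (0 - 2 * Re (cnj (\<phi> z) * ?p * h)) * inverse M)) (at z)"
    unfolding F_def N_def M_def using pos nz
    by (intro has_derivative_diff has_derivative_add has_derivative_mult_right has_derivative_ln
        has_derivative_cmod_square[OF d0] has_derivative_cmod_square[OF d1]
        has_derivative_cmod_square[OF d2] has_derivative_const) auto
  moreover have "(0 - 2 * Re (cnj z * 1 * h)) * inverse N
      + 1 / 2 * (2 * Re (cnj ?p * ?q * h) * inverse ((cmod ?p)\<^sup>2))
      - (0 - 2 * Re (cnj (\<phi> z) * ?p * h)) * inverse M = 2 * Re (A_fun \<phi> z * h) / N" for h
  proof -
    have Re_scale: "Re (of_real r * x) = r * Re x" for r x by simp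
    have "?q / ?p * h = of_real (inverse ((cmod ?p)\<^sup>2)) * (cnj ?p * ?q * h)"
      by (subst complex_div_cnj) (simp add: divide_inverse mult_ac)
    then have q: "Re (?q / ?p * h) = inverse ((cmod ?p)\<^sup>2) * Re (cnj ?p * ?q * h)"
      by (simp only: Re_scale)
    have "A_fun \<phi> z * h = of_real (N / 2) * (?q / ?p * h) - cnj z * h
        + of_real (N / M) * (cnj (\<phi> z) * ?p * h)"
      unfolding A_fun_def N_def[symmetric] M_def[symmetric] by (simp add: algebra_simps)
    then have "Re (A_fun \<phi> z * h) = N / 2 * Re (?q / ?p * h) - Re (cnj z * h)
        + N / M * Re (cnj (\<phi> z) * ?p * h)"
      by (simp only: plus_complex.sel minus_complex.sel Re_scale)
    then have "Re (A_fun \<phi> z * h) = N / 2 * (inverse ((cmod ?p)\<^sup>2) * Re (cnj ?p * ?q * h)) - Re (cnj z * h)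
        + N / M * Re (cnj (\<phi> z) * ?p * h)"
      unfolding q .
    moreover have "(0 - 2 * a) * inverse N + 1 / 2 * (2 * b * i) - (0 - 2 * c) * inverse M = 2 * E / N"
      if "E = N / 2 * (i * b) - a + N / M * c" for a b c i E
      using pos unfolding that N_def[symmetric] M_def[symmetric] by (simp add: field_simps)
    ultimately show ?thesis unfolding mult_1_right by blast
  qed
  ultimately have F: "(F has_derivative (\<lambda>h. 2 * Re (A_fun \<phi> z * h) / N)) (at z)" by simp
  have "F x = ln (u x)" if x: "x \<in> ball 0 1" for x
    using defect_pos[OF x] deriv_ne[OF x] unfolding F_def u_eq[OF x]
    by (simp add: ln_div ln_mult ln_realpow)
  then show ?thesis
    unfolding N_def[symmetric] by (rule has_derivative_transform_within_open[OF F open_ball z]) auto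
qed

text \<open>
  At an extremum the derivative of \<open>ln u\<close> would vanish in every direction, in particular in the
  direction of the conjugate of \<open>A_fun \<phi> z\<close>.
\<close>

lemma not_extremum:
  assumes z: "z \<in> ball 0 1"
  shows "\<not> (\<forall>y\<in>ball 0 1. u y \<le> u z)" "\<not> (\<forall>y\<in>ball 0 1. u z \<le> u y)"
proof -
  have False if "(\<forall>y\<in>ball 0 1. ln (u y) \<le> ln (u z)) \<or> (\<forall>y\<in>ball 0 1. ln (u z) \<le> ln (u y))"
  proof -
    have "(\<lambda>h. 2 * Re (A_fun \<phi> z * h) / (1 - (cmod z)\<^sup>2)) = (\<lambda>h. 0)"
      by (rule differential_zero_maxmin[OF z open_ball ln_u_has_derivative[OF z] that])
    from fun_cong[OF this, of "cnj (A_fun \<phi> z)"] show False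
      using defect_pos[OF z] A_ne[OF z] unfolding complex_norm_square[symmetric] by simp
  qed
  then show "\<not> (\<forall>y\<in>ball 0 1. u y \<le> u z)" "\<not> (\<forall>y\<in>ball 0 1. u z \<le> u y)"
    using u_pos z by auto
qed

lemma u_less_1: "z \<in> ball 0 1 \<Longrightarrow> u z < 1"
  using not_extremum(1)[of z] Schwarz_Pick[OF hol self] by (metis order_le_less)

lemma ln_u_along:
  assumes "w t \<in> ball 0 1" "(w has_vector_derivative v) (at t)"
  shows "((\<lambda>t. ln (u (w t))) has_real_derivative 2 * Re (A_fun \<phi> (w t) * v) / (1 - (cmod (w t))\<^sup>2)) (at t)"
proof -
  have "((\<lambda>t. ln (u (w t))) has_derivative
      (\<lambda>s. 2 * Re (A_fun \<phi> (w t) * (s *\<^sub>R v)) / (1 - (cmod (w t))\<^sup>2))) (at t)"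
    using has_derivative_compose[OF assms(2)[unfolded has_vector_derivative_def] ln_u_has_derivative[OF assms(1)]] .
  then show ?thesis
    by (rule has_derivative_imp_has_field_derivative) (simp add: scaleR_conv_of_real mult.left_commute)
qed

lemmas lipschitz_near_intros = lipschitz_near_const lipschitz_near_id lipschitz_near_norm
  lipschitz_near_of_real lipschitz_near_cnj lipschitz_near_add lipschitz_near_diff
  lipschitz_near_mult lipschitz_near_divide lipschitz_near_power2

lemma lipschitz_near_A:
  assumes z: "z \<in> ball 0 1"
  shows "lipschitz_near z (A_fun \<phi>)"
proof -
  have *: "lipschitz_near z \<phi>" "lipschitz_near z (deriv \<phi>)" "lipschitz_near z (deriv (deriv \<phi>))"
    using z hol by (auto intro!: lipschitz_near_holomorphic[OF _ open_ball] holomorphic_deriv)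
  have "complex_of_real (1 - (cmod (\<phi> z))\<^sup>2) \<noteq> 0"
    using defect_pos[OF z] by (simp only: of_real_eq_0_iff)
  then show ?thesis unfolding A_fun_def [abs_def] using deriv_ne[OF z]
    by (intro lipschitz_near_intros * ) auto
qed

lemma lipschitz_near_u:
  assumes z: "z \<in> ball 0 1"
  shows "lipschitz_near z u"
proof -
  have *: "lipschitz_near z \<phi>" "lipschitz_near z (deriv \<phi>)"
    using z hol by (auto intro!: lipschitz_near_holomorphic[OF _ open_ball] holomorphic_deriv)
  have "complex_of_real (1 - (cmod (\<phi> z))\<^sup>2) \<noteq> 0"
    using defect_pos[OF z] by (simp only: of_real_eq_0_iff)
  then show ?thesis unfolding hyp_deriv_def [abs_def]
    by (intro lipschitz_near_intros * ) auto
qed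

lemma u_isCont: "z \<in> ball 0 1 \<Longrightarrow> isCont u z"
  by (rule lipschitz_near_isCont[OF lipschitz_near_u])

lemma u_continuous: "continuous_on (ball 0 1) u"
  by (simp add: continuous_at_imp_continuous_on u_isCont)

text \<open>
  The right-hand side of the trajectory equation with the time \<open>t\<close> replaced by \<open>u z\<close>. Along a trajectory
  the two are equal, so the autonomous equation has the same solutions.
\<close>

definition traj_field :: "complex \<Rightarrow> complex" where
  "traj_field z = of_real (1 - (cmod z)\<^sup>2) / (2 * of_real (u z) * A_fun \<phi> z)"

text \<open>
  The gradient of \<open>ln u\<close> turned by a right angle, so that \<open>u\<close> is constant along its integral curves. The
  scaling bounds its hyperbolic length, which makes the flow complete.
\<close>

definition level_field :: "complex \<Rightarrow> complex" where
  "level_field z = of_real ((1 - (cmod z)\<^sup>2) / (1 + (cmod (A_fun \<phi> z))\<^sup>2)) * (\<i> * cnj (A_fun \<phi> z))"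

lemma lipschitz_traj_field: "\<forall>z\<in>ball 0 1. lipschitz_near z traj_field"
proof
  fix z :: complex assume z: "z \<in> ball 0 1"
  show "lipschitz_near z traj_field"
    unfolding traj_field_def [abs_def] using A_ne[OF z] u_pos[OF z]
    by (intro lipschitz_near_intros lipschitz_near_A lipschitz_near_u z) auto
qed

lemma lipschitz_level_field: "\<forall>z\<in>ball 0 1. lipschitz_near z level_field"
proof
  fix z :: complex assume z: "z \<in> ball 0 1"
  have "1 + (cmod (A_fun \<phi> z))\<^sup>2 \<noteq> 0" by (smt (verit) zero_le_power2)
  then show "lipschitz_near z level_field"
    unfolding level_field_def [abs_def] 
    by (intro lipschitz_near_intros lipschitz_near_A lipschitz_near_u z) auto
qed

end

section \<open>Trajectories\<close>

text \<open>
  Brings the time domain of a maximal solution into the form \<open>(a, b)\<close> that trajectories are defined with.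
\<close>

lemma open_connected_bounded_real:
  fixes I :: "real set"
  assumes "open I" "connected I" "bounded I" "I \<noteq> {}"
  shows "I = {Inf I<..<Sup I}"
proof
  have bdd: "bdd_below I" "bdd_above I"
    using assms bounded_imp_bdd_below bounded_imp_bdd_above by auto
  show "I \<subseteq> {Inf I<..<Sup I}"
  proof
    fix x assume "x \<in> I"
    then obtain e where e: "0 < e" "cball x e \<subseteq> I" using assms open_contains_cball by blast
    then have "x - e \<in> I" "x + e \<in> I" by (auto simp: subset_iff dist_real_def)
    then have "Inf I \<le> x - e" "x + e \<le> Sup I" using bdd by (auto intro: cInf_lower cSup_upper)
    then show "x \<in> {Inf I<..<Sup I}" using e by auto
  qed
  show "{Inf I<..<Sup I} \<subseteq> I"
  proof
    fix x assume "x \<in> {Inf I<..<Sup I}"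
    then obtain y z where "y \<in> I" "y < x" "z \<in> I" "x < z"
      using assms bdd by (auto simp: cInf_less_iff less_cSup_iff)
    then show "x \<in> I" using assms(2) by (meson connectedD_interval less_imp_le)
  qed
qed

lemma real_interval_constant:
  fixes g :: "real \<Rightarrow> real"
  assumes "connected I" "\<And>t. t \<in> I \<Longrightarrow> (g has_real_derivative 0) (at t)" "s \<in> I" "t \<in> I"
  shows "g s = g t"
proof -
  have "convex I" using assms(1) by (simp add: is_interval_connected_1 flip: is_interval_convex_1)
  then obtain k where "\<forall>x\<in>I. g x = k"
    using has_field_derivative_zero_constant[of I g] assms(2) has_field_derivative_at_within by blast
  with assms show ?thesis by simp
qed

context noncritical_self_map
begin

text \<open>
  The factor in \<open>traj_field\<close> is chosen so that \<open>u\<close> has derivative 1 along the integral curves; therefore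
  \<open>u (w t) - t\<close> is constant.
\<close>

lemma u_along_traj_field:
  assumes w: "ode_solution traj_field (ball 0 1) I w" and t0: "t0 \<in> I" "u (w t0) = t0" and t: "t \<in> I"
  shows "u (w t) = t"
proof -
  have "((\<lambda>t. u (w t) - t) has_real_derivative 0) (at t)" if t: "t \<in> I" for t
  proof -
    have D: "w t \<in> ball 0 1" and w': "(w has_vector_derivative traj_field (w t)) (at t)"
      using ode_solutionD[OF w] t by auto
    note pos = defect_pos(1)[OF D] u_pos[OF D] A_ne[OF D]
    have "A_fun \<phi> (w t) * traj_field (w t) = of_real ((1 - (cmod (w t))\<^sup>2) / (2 * u (w t)))"
      using pos by (simp add: traj_field_def)
    then have "2 * Re (A_fun \<phi> (w t) * traj_field (w t)) / (1 - (cmod (w t))\<^sup>2) = 1 / u (w t)"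
      using pos by (simp only: Re_complex_of_real) (simp add: field_simps)
    with ln_u_along[OF D w'] have "((\<lambda>t. ln (u (w t))) has_real_derivative 1 / u (w t)) (at t)" by simp
    from DERIV_chain2[OF DERIV_exp this]
    have "((\<lambda>t. exp (ln (u (w t)))) has_real_derivative 1) (at t)" using pos by simp
    then have "((\<lambda>t. u (w t)) has_real_derivative 1) (at t)"
      by (rule has_field_derivative_transform_within_open[OF _ ode_solutionD(1)[OF w] t])
        (use u_pos ode_solutionD(3)[OF w] in auto)
    from DERIV_diff[OF this DERIV_ident] show ?thesis by simp
  qed
  from real_interval_constant[OF ode_solutionD(2)[OF w] this t0(1) t] t0(2)
  show ?thesis by simp
qed

lemma traj_dom_eq: "traj_dom \<phi> = ball 0 1"
  unfolding traj_dom_def using deriv_ne A_ne by auto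

text \<open>
  For a solution of the time-dependent problem \<open>ln u (w t)\<close> and \<open>ln t\<close> have the same derivative, hence
  \<open>u (w t) = t\<close>, and the equation is the autonomous one. For an autonomous solution the same identity
  holds by \<open>u_along_traj_field\<close>.
\<close>

lemma ivp_solution_iff:
  assumes z0: "z0 \<in> ball 0 1"
  shows "ivp_solution \<phi> z0 a b w \<longleftrightarrow> 0 \<le> a \<and> b \<le> 1 \<and> u z0 \<in> {a<..<b} \<and> w (u z0) = z0 \<and>
    ode_solution traj_field (ball 0 1) {a<..<b} w"
proof
  assume ivp: "ivp_solution \<phi> z0 a b w"
  then have ab: "0 \<le> a" "b \<le> 1" "u z0 \<in> {a<..<b}" "w (u z0) = z0"
    and w: "\<And>t. t \<in> {a<..<b} \<Longrightarrow> w t \<in> ball 0 1"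
      "\<And>t. t \<in> {a<..<b} \<Longrightarrow> (w has_vector_derivative
          of_real (1 - (cmod (w t))\<^sup>2) / (2 * of_real t * A_fun \<phi> (w t))) (at t)"
    unfolding ivp_solution_def traj_dom_eq by auto
  have u: "u (w t) = t" if t: "t \<in> {a<..<b}" for t
  proof -
    have "((\<lambda>t. ln (u (w t)) - ln t) has_real_derivative 0) (at t)" if t: "t \<in> {a<..<b}" for t
    proof -
      note pos = defect_pos(1)[OF w(1)[OF t]] u_pos[OF w(1)[OF t]] A_ne[OF w(1)[OF t]]
      have t0: "0 < t" using t ab by auto
      let ?v = "of_real (1 - (cmod (w t))\<^sup>2) / (2 * of_real t * A_fun \<phi> (w t))"
      have "A_fun \<phi> (w t) * ?v = of_real ((1 - (cmod (w t))\<^sup>2) / (2 * t))"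
        using pos t0 by simp
      then have "2 * Re (A_fun \<phi> (w t) * ?v) / (1 - (cmod (w t))\<^sup>2) = 1 / t"
        using pos t0 by (simp only: Re_complex_of_real) (simp add: field_simps)
      with ln_u_along[OF w(1)[OF t] w(2)[OF t]]
      have "((\<lambda>t. ln (u (w t))) has_real_derivative 1 / t) (at t)" by simp
      from DERIV_diff[OF this DERIV_ln_divide[OF t0]] show ?thesis by simp
    qed
    from real_interval_constant[OF _ this ab(3) t] ab
    have "ln (u (w t)) = ln t" by simp
    moreover have "0 < t" using t ab by auto
    ultimately show ?thesis using u_pos[OF w(1)[OF t]] by simp
  qed
  show "0 \<le> a \<and> b \<le> 1 \<and> u z0 \<in> {a<..<b} \<and> w (u z0) = z0 \<and>
    ode_solution traj_field (ball 0 1) {a<..<b} w"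
    using ab w u unfolding ode_solution_def traj_field_def by auto
next
  assume *: "0 \<le> a \<and> b \<le> 1 \<and> u z0 \<in> {a<..<b} \<and> w (u z0) = z0 \<and>
    ode_solution traj_field (ball 0 1) {a<..<b} w"
  then have "u (w t) = t" if "t \<in> {a<..<b}" for t
    using u_along_traj_field[of "{a<..<b}" w "u z0" t] that by auto
  with * show "ivp_solution \<phi> z0 a b w"
    unfolding ivp_solution_def traj_dom_eq ode_solution_def traj_field_def by auto
qed

lemma u_along_trajectory:
  assumes "trajectory \<phi> z0 a b w" "t \<in> {a<..<b}"
  shows "w t \<in> ball 0 1" "u (w t) = t"
proof -
  have "z0 \<in> ball 0 1" "ivp_solution \<phi> z0 a b w"
    using assms(1) unfolding trajectory_def traj_dom_eq by auto
  then have *: "u z0 \<in> {a<..<b}" "w (u z0) = z0" "ode_solution traj_field (ball 0 1) {a<..<b} w"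
    using ivp_solution_iff by auto
  show "w t \<in> ball 0 1" using ode_solutionD(3)[OF *(3) assms(2)] .
  show "u (w t) = t" using u_along_traj_field[OF *(3,1) _ assms(2)] *(2) by simp
qed

text \<open>
  The maximal autonomous solution with times in \<open>(0, 1)\<close>. It contains every competitor in the
  definition of a trajectory, so it is maximal in that sense too.
\<close>

lemma trajectory_exists:
  assumes z0: "z0 \<in> ball 0 1"
  obtains a b w where "trajectory \<phi> z0 a b w"
proof -
  let ?J = "{0<..<1::real}"
  have J: "open ?J" "u z0 \<in> ?J" using u_pos[OF z0] u_less_1[OF z0] by auto
  obtain I w where w: "ode_solution traj_field (ball 0 1) I w" and I: "I \<subseteq> ?J" "u z0 \<in> I" "w (u z0) = z0"
    and max: "\<forall>I' w'. ode_solution traj_field (ball 0 1) I' w' \<and> I' \<subseteq> ?J \<and> u z0 \<in> I' \<and> w' (u z0) = z0 \<longrightarrow>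
      I' \<subseteq> I \<and> (\<forall>t\<in>I'. w' t = w t)"
    by (rule ode_maximal_solution[OF lipschitz_traj_field open_ball z0 J]) (rule that)
  define a b where "a = Inf I" and "b = Sup I"
  have Iab: "I = {a<..<b}"
    unfolding a_def b_def
    by (rule open_connected_bounded_real)
      (use ode_solutionD[OF w] I bounded_subset[OF _ I(1)] in auto)
  have ab: "a < b" "0 \<le> a" "b \<le> 1"
    using I unfolding Iab by (auto simp: greaterThanLessThan_subseteq_greaterThanLessThan)
  have "trajectory \<phi> z0 a b w"
    unfolding trajectory_def traj_dom_eq
  proof (intro conjI allI impI z0)
    show "ivp_solution \<phi> z0 a b w"
      unfolding ivp_solution_iff[OF z0] using ab w I Iab by auto
    fix a' b' w'
    assume *: "ivp_solution \<phi> z0 a' b' w' \<and> a' \<le> a \<and> b \<le> b' \<and> (\<forall>t\<in>{a<..<b}. w' t = w t)"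
    then have s: "0 \<le> a'" "b' \<le> 1" "u z0 \<in> {a'<..<b'}" "w' (u z0) = z0"
      "ode_solution traj_field (ball 0 1) {a'<..<b'} w'" "a' \<le> a" "b \<le> b'"
      using ivp_solution_iff[OF z0] by auto
    have "{a'<..<b'} \<subseteq> {a<..<b}"
    proof -
      have "{a'<..<b'} \<subseteq> ?J" using s by auto
      then show ?thesis using max[rule_format, of "{a'<..<b'}" w'] s(3-5) unfolding Iab by blast
    qed
    then show "a' = a" "b' = b"
      using s ab by (auto simp: greaterThanLessThan_subseteq_greaterThanLessThan)
  qed
  then show thesis by (rule that)
qed

section \<open>Level sets are open arcs\<close>

lemma ode_solution_level_field_u:
  assumes w: "ode_solution level_field (ball 0 1) I w" and "s \<in> I" "t \<in> I"
  shows "u (w s) = u (w t)"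
proof -
  have "((\<lambda>t. ln (u (w t))) has_real_derivative 0) (at t)" if t: "t \<in> I" for t
  proof -
    have "A_fun \<phi> z * level_field z = \<i> * of_real ((1 - (cmod z)\<^sup>2) / (1 + (cmod (A_fun \<phi> z))\<^sup>2) * (cmod (A_fun \<phi> z))\<^sup>2)" for z
      unfolding level_field_def of_real_mult complex_norm_square[of "A_fun \<phi> z"] by (simp only: mult_ac)
    then have "Re (A_fun \<phi> z * level_field z) = 0" for z by (simp only: Re_i_times Im_complex_of_real)
    then show ?thesis
      using ln_u_along[OF ode_solutionD(3)[OF w t] ode_solutionD(4)[OF w t]] by simp
  qed
  from real_interval_constant[OF ode_solutionD(2)[OF w] this assms(2,3)] show ?thesis
    using u_pos ode_solutionD(3)[OF w] assms by simp
qed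

text \<open>
  This is \<open>x / (1 + x\<^sup>2) \<le> 1 / 2\<close> for \<open>x = \<bar>A_fun \<phi> z\<bar>\<close>.
\<close>

lemma level_field_bound:
  assumes "z \<in> ball 0 1"
  shows "cmod (level_field z) \<le> (1 - (cmod z)\<^sup>2) / 2"
proof -
  let ?a = "cmod (A_fun \<phi> z)"
  have pos: "0 < 1 + ?a\<^sup>2" by (smt (verit) zero_le_power2)
  have "?a / (1 + ?a\<^sup>2) \<le> 1 / 2"
    using pos sum_squares_bound[of ?a 1] by (simp add: field_simps)
  then have "(1 - (cmod z)\<^sup>2) * (?a / (1 + ?a\<^sup>2)) \<le> (1 - (cmod z)\<^sup>2) * (1 / 2)"
    using defect_pos(1)[OF assms] by (intro mult_left_mono) auto
  moreover have "cmod (level_field z) = (1 - (cmod z)\<^sup>2) * (?a / (1 + ?a\<^sup>2))"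
    using defect_pos(1)[OF assms] pos unfolding level_field_def norm_mult norm_of_real by simp
  ultimately show ?thesis by simp
qed

text \<open>
  By \<open>level_field_bound\<close> the function \<open>ln (1 - \<bar>w t\<bar>\<^sup>2)\<close> changes at rate at most 1, so during a bounded
  time the solution stays in a compact subset of the disc.
\<close>

lemma level_flow_exists:
  assumes z0: "z0 \<in> ball 0 1"
  obtains w where "ode_solution level_field (ball 0 1) UNIV w" "w 0 = z0"
proof (rule ode_global_solution[OF lipschitz_level_field open_ball z0])
  fix R :: real
  \<comment> \<open>The value that \<open>1 - \<bar>w t\<bar>\<^sup>2\<close> would reach after time \<open>R\<close> at the maximal rate of decrease.\<close>
  define m where "m = exp (ln (1 - (cmod z0)\<^sup>2) - R)"
  define K where "K = {z :: complex. m \<le> 1 - (cmod z)\<^sup>2}"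
  have m: "0 < m" by (simp add: m_def)
  have "K \<subseteq> ball 0 1"
  proof
    fix z assume "z \<in> K"
    then have "(cmod z)\<^sup>2 < 1" using m by (simp add: K_def)
    then show "z \<in> ball 0 1" by (simp add: abs_square_less_1)
  qed
  moreover have "closed K"
    unfolding K_def by (intro closed_Collect_le continuous_intros)
  ultimately have "compact K"
    using bounded_subset[OF bounded_ball] by (auto simp: compact_eq_bounded_closed)
  moreover have "w t \<in> K"
    if w: "ode_solution level_field (ball 0 1) I w" and "0 \<in> I" "w 0 = z0" "t \<in> I" "\<bar>t\<bar> \<le> R" for I w t
  proof -
    let ?h = "\<lambda>t. ln (1 - (cmod (w t))\<^sup>2)"
    have "norm (?h t - ?h 0) \<le> 1 * norm (t - 0)"
    proof (rule field_differentiable_bound)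
      show "convex I"
        using ode_solutionD(2)[OF w] by (simp add: is_interval_connected_1 flip: is_interval_convex_1)
      fix s assume s: "s \<in> I"
      let ?v = "level_field (w s)"
      have D: "w s \<in> ball 0 1" using ode_solutionD(3)[OF w s] .
      have w': "(w has_derivative (\<lambda>x. x *\<^sub>R ?v)) (at s)"
        using ode_solutionD(4)[OF w s] by (simp add: has_vector_derivative_def)
      have "((\<lambda>t. w t \<bullet> w t) has_derivative (\<lambda>x. w s \<bullet> (x *\<^sub>R ?v) + (x *\<^sub>R ?v) \<bullet> w s)) (at s)"
        by (rule has_derivative_inner[OF w' w'])
      then have "((\<lambda>t. (cmod (w t))\<^sup>2) has_real_derivative 2 * (w s \<bullet> ?v)) (at s)"
        unfolding power2_norm_eq_inner
        by (rule has_derivative_imp_has_field_derivative) (simp add: inner_commute)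
      from DERIV_chain2[OF DERIV_ln_divide[OF defect_pos(1)[OF D]] DERIV_diff[OF DERIV_const this]]
      have "(?h has_real_derivative (0 - 2 * (w s \<bullet> ?v)) / (1 - (cmod (w s))\<^sup>2)) (at s)"
        by simp
      then show "(?h has_real_derivative (0 - 2 * (w s \<bullet> ?v)) / (1 - (cmod (w s))\<^sup>2)) (at s within I)"
        by (rule has_field_derivative_at_within)
      have "\<bar>w s \<bullet> ?v\<bar> \<le> cmod (w s) * cmod ?v" by (rule Cauchy_Schwarz_ineq2)
      also have "\<dots> \<le> 1 * ((1 - (cmod (w s))\<^sup>2) / 2)"
        using D level_field_bound[OF D] by (intro mult_mono) auto
      finally show "norm ((0 - 2 * (w s \<bullet> ?v)) / (1 - (cmod (w s))\<^sup>2)) \<le> 1"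
        using defect_pos(1)[OF D] by (simp add: field_simps abs_mult)
    qed (use that in auto)
    then have "ln (1 - (cmod z0)\<^sup>2) - R \<le> ?h t" using that by simp
    then have "m \<le> exp (?h t)" by (simp add: m_def)
    then show ?thesis using defect_pos(1)[OF ode_solutionD(3)[OF w \<open>t \<in> I\<close>]] by (simp add: K_def)
  qed
  ultimately show "\<exists>K. compact K \<and> K \<subseteq> ball 0 1 \<and>
      (\<forall>I w. ode_solution level_field (ball 0 1) I w \<longrightarrow> 0 \<in> I \<longrightarrow> w 0 = z0 \<longrightarrow> w ` (I \<inter> cball 0 R) \<subseteq> K)"
    using \<open>K \<subseteq> ball 0 1\<close> by (intro exI[of _ K]) auto
qed (rule that)

text \<open>
  Near \<open>z0 = w s0\<close> the level set is a graph over the coordinate \<open>Im (A0 z)\<close>, where \<open>A0 = A_fun \<phi> z0\<close>. Two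
  points with the same coordinate differ by a multiple of \<open>1 / A0\<close>, the direction of the gradient at
  \<open>z0\<close>, in which \<open>u\<close> is strictly monotone; so a point of the level set is determined by its
  coordinate. Along the orbit the coordinate has positive derivative at \<open>s0\<close>, and by the intermediate
  value theorem the orbit takes every coordinate near that of \<open>z0\<close>. Hence it contains every nearby
  point of the level set.
\<close>

lemma level_orbit_neighbourhood:
  assumes w: "ode_solution level_field (ball 0 1) UNIV w" and \<delta>: "0 < \<delta>"
  obtains e where "0 < e" "level_set \<phi> (u (w s0)) \<inter> ball (w s0) e \<subseteq> w ` ball s0 \<delta>"
proof -
  define z0 where "z0 = w s0"
  define A0 where "A0 = A_fun \<phi> z0"
  let ?S = "level_set \<phi> (u z0)"
  have z0: "z0 \<in> ball 0 1" using ode_solutionD(3)[OF w] by (simp add: z0_def)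
  have A0: "A0 \<noteq> 0" using A_ne[OF z0] by (simp add: A0_def)
  have "isCont (\<lambda>z. Re (A_fun \<phi> z / A0)) z0"
    using lipschitz_near_isCont[OF lipschitz_near_A[OF z0]] A0 by (intro isCont_Re isCont_divide continuous_const)
  moreover have "Re (A_fun \<phi> z0 / A0) > 0" using A0 by (simp add: A0_def)
  ultimately obtain e' where "0 < e'" "\<And>z. dist z z0 < e' \<Longrightarrow>
      dist (Re (A_fun \<phi> z / A0)) (Re (A_fun \<phi> z0 / A0)) < Re (A_fun \<phi> z0 / A0)"
    unfolding continuous_at_eps_delta by blast
  then have e': "0 < e'" "\<And>z. dist z0 z < e' \<Longrightarrow> Re (A_fun \<phi> z / A0) > 0"
    by (auto simp: dist_real_def dist_commute abs_less_iff)
  obtain e'' where e'': "0 < e''" "ball z0 e'' \<subseteq> ball 0 1"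
    using z0 open_contains_ball[of "ball 0 1"] by blast
  define e1 where "e1 = min e' e''"
  have e1: "0 < e1" "ball z0 e1 \<subseteq> ball 0 1" "\<And>z. z \<in> ball z0 e1 \<Longrightarrow> Re (A_fun \<phi> z / A0) > 0"
    using e' e'' by (auto simp: e1_def)
  have inj: "x = y" if xy: "x \<in> ?S \<inter> ball z0 e1" "y \<in> ?S \<inter> ball z0 e1" "Im (A0 * x) = Im (A0 * y)" for x y
  proof (rule ccontr)
    assume "x \<noteq> y"
    define \<tau> where "\<tau> = Re (A0 * (y - x))"
    have "A0 * (y - x) = of_real \<tau>" using xy(3) by (simp add: \<tau>_def complex_eq_iff algebra_simps)
    then have yx: "y - x = of_real \<tau> / A0" using A0 by (simp add: field_simps)
    then have \<tau>: "\<tau> \<noteq> 0" using \<open>x \<noteq> y\<close> by auto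
    define p where "p = (\<lambda>s :: real. x + s *\<^sub>R (y - x))"
    have p: "p s \<in> ball z0 e1" if "0 \<le> s" "s \<le> 1" for s
    proof -
      have "(1 - s) *\<^sub>R x + s *\<^sub>R y \<in> ball z0 e1"
        using that xy(1,2) by (intro convexD[OF convex_ball]) auto
      then show ?thesis by (simp add: p_def algebra_simps)
    qed
    have p': "(p has_vector_derivative (y - x)) (at s)" for s
      unfolding p_def by (auto intro!: derivative_eq_intros)
    define g' where "g' = (\<lambda>s. 2 * Re (A_fun \<phi> (p s) * (y - x)) / (1 - (cmod (p s))\<^sup>2))"
    have g: "((\<lambda>s. ln (u (p s))) has_real_derivative g' s) (at s)" if "0 \<le> s" "s \<le> 1" for s
      unfolding g'_def using ln_u_along[of p s, OF _ p'] p[OF that] e1(2) by blast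
    obtain s where s: "0 < s" "s < 1" "ln (u (p 1)) - ln (u (p 0)) = (1 - 0) * g' s"
      using MVT2[of 0 1 "\<lambda>s. ln (u (p s))" g'] g by auto
    have "ln (u (p 1)) = ln (u (p 0))" using xy by (simp add: p_def level_set_def)
    then have "g' s = 0" using s by simp
    moreover have D: "p s \<in> ball z0 e1" using p[of s] s by simp
    then have "0 < 1 - (cmod (p s))\<^sup>2" using defect_pos(1) e1(2) by blast
    moreover have "A_fun \<phi> (p s) * (y - x) = of_real \<tau> * (A_fun \<phi> (p s) / A0)"
      unfolding yx by simp
    then have "Re (A_fun \<phi> (p s) * (y - x)) = \<tau> * Re (A_fun \<phi> (p s) / A0)"
      by (simp only: Re_complex_of_real times_complex.sel Im_complex_of_real)
    ultimately show False using e1(3)[OF D] \<tau> by (simp add: g'_def)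
  qed
  have w_cont: "isCont w s" for s using ode_solutionD(5)[OF w] by simp
  obtain \<delta>1 where d1: "0 < \<delta>1" "\<delta>1 \<le> \<delta>" "\<And>s. s \<in> ball s0 \<delta>1 \<Longrightarrow> w s \<in> ball z0 e1"
  proof -
    obtain d where "0 < d" "\<And>s. dist s s0 < d \<Longrightarrow> dist (w s) z0 < e1"
      using w_cont[of s0] e1(1) unfolding continuous_at_eps_delta z0_def by blast
    then show thesis using that[of "min d \<delta>"] \<delta> by (auto simp: dist_commute)
  qed
  define l where "l = (\<lambda>s. Im (A0 * w s))"
  have l_cont: "isCont l s" for s unfolding l_def by (intro isCont_Im isCont_mult continuous_const w_cont)
  have "bounded_linear (\<lambda>z. Im (A0 * z))"
    by (intro bounded_linear_compose[OF bounded_linear_Im] bounded_linear_mult_right)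
  from bounded_linear.has_vector_derivative[OF this ode_solutionD(4)[OF w UNIV_I, of s0]]
  have l': "(l has_real_derivative Im (A0 * level_field z0)) (at s0)"
    by (simp add: l_def z0_def has_real_derivative_iff_has_vector_derivative)
  have "Im (A0 * level_field z0) > 0"
  proof -
    have "A0 * level_field z0 = \<i> * of_real ((1 - (cmod z0)\<^sup>2) / (1 + (cmod A0)\<^sup>2) * (cmod A0)\<^sup>2)"
      unfolding level_field_def A0_def of_real_mult complex_norm_square[of "A_fun \<phi> z0"] by (simp only: mult_ac)
    then have "Im (A0 * level_field z0) = (1 - (cmod z0)\<^sup>2) / (1 + (cmod A0)\<^sup>2) * (cmod A0)\<^sup>2"
      by (simp only: Im_i_times Re_complex_of_real)
    moreover have "0 < 1 + (cmod A0)\<^sup>2" by (smt (verit) zero_le_power2)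
    ultimately show ?thesis using defect_pos(1)[OF z0] A0 by simp
  qed
  from DERIV_pos_inc_right[OF l' this] DERIV_pos_inc_left[OF l' this]
  obtain d2 d3 where d23: "0 < d2" "0 < d3" "\<And>h. 0 < h \<Longrightarrow> h < d2 \<Longrightarrow> l s0 < l (s0 + h)"
    "\<And>h. 0 < h \<Longrightarrow> h < d3 \<Longrightarrow> l (s0 - h) < l s0"
    by blast
  define h where "h = min \<delta>1 (min d2 d3) / 2"
  have h: "0 < h" "h < \<delta>1" "l (s0 - h) < l s0" "l s0 < l (s0 + h)"
    using d1 d23 by (auto simp: h_def)
  have "open ((\<lambda>z. Im (A0 * z)) -` {l (s0 - h)<..<l (s0 + h)} \<inter> ball z0 e1)"
    by (intro open_Int open_vimage) (auto intro!: continuous_intros)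
  moreover have "z0 \<in> (\<lambda>z. Im (A0 * z)) -` {l (s0 - h)<..<l (s0 + h)} \<inter> ball z0 e1"
    using h e1 by (auto simp: l_def z0_def)
  ultimately obtain e where e: "0 < e" "ball z0 e \<subseteq> (\<lambda>z. Im (A0 * z)) -` {l (s0 - h)<..<l (s0 + h)} \<inter> ball z0 e1"
    unfolding open_contains_ball by blast
  have "?S \<inter> ball z0 e \<subseteq> w ` ball s0 \<delta>"
  proof
    fix x assume x: "x \<in> ?S \<inter> ball z0 e"
    then have lx: "l (s0 - h) \<le> Im (A0 * x)" "Im (A0 * x) \<le> l (s0 + h)" "x \<in> ball z0 e1"
      using e(2) by auto
    obtain s where s: "s0 - h \<le> s" "s \<le> s0 + h" "l s = Im (A0 * x)"
      using IVT[of l "s0 - h" "Im (A0 * x)" "s0 + h"] lx h l_cont by auto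
    then have sb: "s \<in> ball s0 \<delta>1" using h by (auto simp: dist_real_def)
    have "u (w s) = u z0"
      unfolding z0_def by (rule ode_solution_level_field_u[OF w UNIV_I UNIV_I])
    then have "w s \<in> ?S" using ode_solutionD(3)[OF w UNIV_I, of s] by (simp add: level_set_def)
    then have "w s = x" using inj[of "w s" x] d1(3)[OF sb] x lx(3) s(3) by (auto simp: l_def)
    then show "x \<in> w ` ball s0 \<delta>" using sb d1 by auto
  qed
  with e(1) show thesis by (intro that) (auto simp: z0_def)
qed

text \<open>
  A compact level set lies in a smaller disc. The remaining annulus is connected and misses the
  level \<open>t\<close>, so \<open>u\<close> is on one side of \<open>t\<close> there. Then the maximum or the minimum of \<open>u\<close> over the smaller
  closed disc is a global extremum, which does not exist.
\<close>

lemma level_set_not_compact: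
  assumes "level_set \<phi> t \<noteq> {}" shows "\<not> compact (level_set \<phi> t)"
proof
  assume comp: "compact (level_set \<phi> t)"
  obtain m where m: "m \<in> level_set \<phi> t" "\<And>z. z \<in> level_set \<phi> t \<Longrightarrow> cmod z \<le> cmod m"
    using continuous_attains_sup[OF comp assms, of cmod] by (auto intro: continuous_intros)
  \<comment> \<open>Strictly between the largest modulus on the level set and 1, so that the level set lies in an open
    disc and the annulus outside it is connected.\<close>
  define r where "r = (1 + cmod m) / 2"
  have m1: "cmod m < 1" using m(1) by (simp add: level_set_def)
  then have r: "0 \<le> r" "r < 1" "cmod m < r" "cball 0 r \<subseteq> ball (0::complex) 1"
    by (auto simp: r_def)
  have sub: "level_set \<phi> t \<subseteq> ball 0 r" using m(2) r(3) by fastforce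
  let ?Q = "ball (0::complex) 1 - ball 0 r"
  have "connected ?Q" using r by (intro connected_diff_ball) auto
  moreover have "continuous_on ?Q u" by (rule continuous_on_subset[OF u_continuous]) auto
  ultimately have conn: "connected (u ` ?Q)" by (intro connected_continuous_image)
  have t: "t \<notin> u ` ?Q" using sub by (auto simp: level_set_def)
  have split: "(\<forall>z\<in>?Q. u z < t) \<or> (\<forall>z\<in>?Q. t < u z)"
  proof (rule ccontr)
    assume "\<not> ?thesis"
    then obtain x y where "x \<in> ?Q" "y \<in> ?Q" "t \<le> u x" "u y \<le> t" by force
    then have "t \<in> u ` ?Q" using connectedD_interval[OF conn, of "u y" "u x" t] by auto
    with t show False ..
  qed
  have cont: "continuous_on (cball 0 r) u" by (rule continuous_on_subset[OF u_continuous r(4)])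
  have m': "m \<in> cball 0 r" "u m = t" using m r by (auto simp: level_set_def)
  have ne: "cball (0::complex) r \<noteq> {}" using r by auto
  from split show False
  proof
    assume lt: "\<forall>z\<in>?Q. u z < t"
    obtain x where x: "x \<in> cball 0 r" "\<And>z. z \<in> cball 0 r \<Longrightarrow> u z \<le> u x"
      using continuous_attains_sup[OF compact_cball ne cont] by blast
    have "u z \<le> u x" if "z \<in> ball 0 1" for z
    proof (cases "z \<in> ?Q")
      case True
      then show ?thesis using bspec[OF lt True] x(2)[OF m'(1)] m'(2) by linarith
    next
      case False
      then show ?thesis using that by (intro x(2)) auto
    qed
    then show False using not_extremum(1)[of x] x r by blast
  next
    assume gt: "\<forall>z\<in>?Q. t < u z"
    obtain x where x: "x \<in> cball 0 r" "\<And>z. z \<in> cball 0 r \<Longrightarrow> u x \<le> u z"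
      using continuous_attains_inf[OF compact_cball ne cont] by blast
    have "u x \<le> u z" if "z \<in> ball 0 1" for z
    proof (cases "z \<in> ?Q")
      case True
      then show ?thesis using bspec[OF gt True] x(2)[OF m'(1)] m'(2) by linarith
    next
      case False
      then show ?thesis using that by (intro x(2)) auto
    qed
    then show False using not_extremum(2)[of x] x r by blast
  qed
qed

text \<open>
  The orbits of the level field are open in the level set, so a connected level set is a single
  orbit \<open>w\<close>. If \<open>w\<close> were not injective, it would be periodic and its image compact. So \<open>w\<close> is injective,
  continuous, and open onto the level set.
\<close>

lemma connected_level_set_arc:
  assumes conn: "connected (level_set \<phi> t)" and ne: "level_set \<phi> t \<noteq> {}"
  shows "open_Jordan_arc (level_set \<phi> t)"
proof -
  let ?S = "level_set \<phi> t"
  have "\<forall>z\<in>ball 0 1. \<exists>w. ode_solution level_field (ball 0 1) UNIV w \<and> w 0 = z"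
    using level_flow_exists by metis
  then obtain G where G: "\<And>z. z \<in> ball 0 1 \<Longrightarrow> ode_solution level_field (ball 0 1) UNIV (G z)"
    and G0: "\<And>z. z \<in> ball 0 1 \<Longrightarrow> G z 0 = z"
    by metis
  have SD: "z \<in> ball 0 1" if "z \<in> ?S" for z using that by (simp add: level_set_def)
  have GS: "G z s \<in> ?S" if "z \<in> ?S" for z s
    using ode_solution_level_field_u[OF G[OF SD[OF that]] UNIV_I UNIV_I, of s 0] G0[OF SD[OF that]] that
      ode_solutionD(3)[OF G[OF SD[OF that]] UNIV_I, of s]
    by (simp add: level_set_def)
  have shift: "w (\<sigma> + s) = v s"
    if "ode_solution level_field (ball 0 1) UNIV w" "ode_solution level_field (ball 0 1) UNIV v" "w \<sigma> = v 0"
    for w v \<sigma> s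
    using ode_solution_unique[OF lipschitz_level_field ode_solution_shift[OF that(1), of \<sigma>], of v 0 s] that by simp
  have GG: "G (G z s) r = G z (s + r)" if "z \<in> ?S" for z s r
    using shift[OF G[OF SD[OF that]] G[OF SD[OF GS[OF that]]], of s s r] G0[OF SD[OF GS[OF that]]] by simp
  obtain z0 where z0: "z0 \<in> ?S" using ne by blast
  define w where "w = G z0"
  have w: "ode_solution level_field (ball 0 1) UNIV w" using G SD z0 by (simp add: w_def)
  have wS: "w s \<in> ?S" for s using GS[OF z0] by (simp add: w_def)
  have nbhd: "\<exists>e>0. ball (w s) e \<inter> ?S \<subseteq> w ` ball s \<delta>" if "0 < \<delta>" 
      "ode_solution level_field (ball 0 1) UNIV w" "w s \<in> ?S" for w s \<delta>
  proof -
    have "u (w s) = t" using that(3) by (simp add: level_set_def)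
    then show ?thesis using level_orbit_neighbourhood[OF that(2,1), of s] by (metis Int_commute)
  qed
  have range: "range w = ?S"
  proof
    show "range w \<subseteq> ?S" using wS by auto
    show "?S \<subseteq> range w"
    proof
      fix z assume z: "z \<in> ?S"
      have "\<exists>s. z = G z0 s"
      proof (rule connected_equivalence_relation[OF conn z0 z, where R = "\<lambda>a b. \<exists>s. b = G a s"])
        show "\<exists>s. x = G y s" if xy: "\<exists>s. y = G x s" "x \<in> ?S" "y \<in> ?S" for x y
        proof -
          obtain s where "y = G x s" using xy(1) by blast
          then have "G y (- s) = x" using GG[OF xy(2), of s "- s"] G0[OF SD[OF xy(2)]] by simp
          then show ?thesis by metis
        qed
        show "\<exists>s. z = G x s" if "\<exists>s. y = G x s" "\<exists>s. z = G y s" "x \<in> ?S" "y \<in> ?S" "z \<in> ?S" for x y z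
          using that GG[OF that(3)] by metis
        fix a assume a: "a \<in> ?S"
        obtain e where e: "0 < e" "ball a e \<inter> ?S \<subseteq> G a ` ball 0 1"
          using nbhd[of 1 "G a" 0] G[OF SD[OF a]] G0[OF SD[OF a]] a by auto
        show "\<exists>T. openin (top_of_set ?S) T \<and> a \<in> T \<and> (\<forall>x\<in>T. \<exists>s. x = G a s)"
          using e a by (intro exI[of _ "?S \<inter> ball a e"]) (auto simp: openin_open_Int)
      qed
      then show "z \<in> range w" by (auto simp: w_def)
    qed
  qed
  have "inj w"
  proof (rule ccontr)
    assume "\<not> inj w"
    then obtain s1 s2 where s: "s1 < s2" "w s1 = w s2"
      unfolding inj_on_def by (metis linorder_less_linear)
    define T where "T = s2 - s1"
    have per: "w (r + T) = w r" for r
    proof -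
      have "w (s2 + (r - s1)) = G (w s1) (r - s1)" "w (s1 + (r - s1)) = G (w s1) (r - s1)"
        using shift[OF w G[OF SD[OF wS[of s1]]], of s2 "r - s1"] shift[OF w G[OF SD[OF wS[of s1]]], of s1 "r - s1"]
          s(2) G0[OF SD[OF wS[of s1]]] by simp_all
      then show ?thesis by (simp add: T_def algebra_simps)
    qed
    have T: "0 < T" using s by (simp add: T_def)
    let ?P = "w ` {s1..s2}"
    \<comment> \<open>The neighbourhoods of the endpoints \<open>s1\<close> and \<open>s2\<close> wrap around by periodicity, so the image of one
    period is open in the level set.\<close>
    have shiftP: "w r \<in> ?P" if "s1 - T < r" "r < s2 + T" for r
    proof -
      consider "r < s1" | "r \<in> {s1..s2}" | "s2 < r" by fastforce
      then show ?thesis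
      proof cases
        case 1
        then have "r + T \<in> {s1..s2}" using that by (auto simp: T_def)
        then show ?thesis using per[of r] by (metis imageI)
      next
        case 3
        then have "r - T \<in> {s1..s2}" using that by (auto simp: T_def)
        then show ?thesis using per[of "r - T"] by (metis imageI diff_add_cancel)
      qed auto
    qed
    have compP: "compact ?P"
      using ode_solutionD(6)[OF w] by (intro compact_continuous_image) (auto intro: continuous_on_subset)
    have "closedin (top_of_set ?S) ?P"
      using compP wS by (intro closed_subset compact_imp_closed) auto
    moreover have "openin (top_of_set ?S) ?P"
      unfolding openin_contains_ball
    proof (intro conjI ballI)
      show "?P \<subseteq> ?S" using wS by auto
      fix x assume "x \<in> ?P"
      then obtain r where r: "r \<in> {s1..s2}" "x = w r" by auto
      obtain e where e: "0 < e" "ball (w r) e \<inter> ?S \<subseteq> w ` ball r T"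
        using nbhd[OF T w wS] by blast
      moreover have "w ` ball r T \<subseteq> ?P" using r shiftP by (force simp: dist_real_def)
      ultimately show "\<exists>e>0. ball x e \<inter> ?S \<subseteq> ?P" using r by blast
    qed
    ultimately have "?P = {} \<or> ?P = ?S" using conn connected_clopen by blast
    then have "?P = ?S" using s by auto
    then show False using compP level_set_not_compact[OF ne] by simp
  qed
  moreover have "openin (top_of_set ?S) (w ` U)" if U: "openin (top_of_set UNIV) U" for U
    unfolding openin_contains_ball
  proof (intro conjI ballI)
    show "w ` U \<subseteq> ?S" using wS by auto
    fix x assume "x \<in> w ` U"
    then obtain s where s: "s \<in> U" "x = w s" by auto
    obtain d where d: "0 < d" "ball s d \<subseteq> U" using U s unfolding subtopology_UNIV open_openin[symmetric] open_contains_ball by blast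
    show "\<exists>e>0. ball x e \<inter> ?S \<subseteq> w ` U" using nbhd[OF d(1) w wS, of s] s d by blast
  qed
  ultimately obtain g where "homeomorphism UNIV ?S w g"
    using homeomorphism_injective_open_map[of UNIV w ?S] ode_solutionD(6)[OF w] range by blast
  then have "(UNIV :: real set) homeomorphic ?S" unfolding homeomorphic_def by blast
  moreover have "{0<..<1::real} homeomorphic (UNIV :: real set)"
    by (rule homeomorphic_open_interval_UNIV) simp
  ultimately have "{0<..<1::real} homeomorphic ?S" by (rule homeomorphic_trans[rotated])
  then show ?thesis unfolding open_Jordan_arc_def by (rule homeomorphic_sym[THEN iffD1])
qed

end

section \<open>The set on which the trajectories end\<close>

text \<open>
  Since \<open>u\<close> equals the time along a trajectory, the assumption lets every point of the disc be moved
  along its trajectory to any prescribed level in \<open>(c, d)\<close>.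
\<close>

locale full_trajectories = noncritical_self_map +
  fixes c d :: real
  assumes full: "trajectory \<phi> z0 a b w \<Longrightarrow> a = c \<and> b = d"
begin

lemma full_flow:
  obtains W where "\<And>z. z \<in> ball 0 1 \<Longrightarrow> ode_solution traj_field (ball 0 1) {c<..<d} (W z)"
    "\<And>z. z \<in> ball 0 1 \<Longrightarrow> W z (u z) = z"
proof -
  have "\<exists>w. ode_solution traj_field (ball 0 1) {c<..<d} w \<and> w (u z) = z" if z: "z \<in> ball 0 1" for z
  proof -
    obtain a b w where w: "trajectory \<phi> z a b w" using trajectory_exists[OF z] by blast
    with full[OF w] have "ivp_solution \<phi> z c d w" by (simp add: trajectory_def)
    then show ?thesis using ivp_solution_iff[OF z] by blast
  qed
  then show thesis using that by metis
qed

lemma u_range: "z \<in> ball 0 1 \<Longrightarrow> u z \<in> {c<..<d}"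
proof -
  assume z: "z \<in> ball 0 1"
  obtain a b w where w: "trajectory \<phi> z a b w" using trajectory_exists[OF z] by blast
  with full[OF w] have "ivp_solution \<phi> z c d w" by (simp add: trajectory_def)
  then show ?thesis using ivp_solution_iff[OF z] by blast
qed

text \<open>
  Moving \<open>z\<close> along its trajectory to the time \<open>t\<close> maps the disc continuously onto the level set. Moving
  it only when \<open>u z < t\<close>, that is, to the time \<open>max t (u z)\<close>, gives the superlevel set. Continuous
  images of the disc are connected.
\<close>

lemma connected_sets:
  assumes t: "t \<in> {c<..<d}"
  shows "connected (superlevel_set \<phi> t)" "connected (level_set \<phi> t)" "level_set \<phi> t \<noteq> {}"
proof -
  obtain W where W: "\<And>z. z \<in> ball 0 1 \<Longrightarrow> ode_solution traj_field (ball 0 1) {c<..<d} (W z)"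
    "\<And>z. z \<in> ball 0 1 \<Longrightarrow> W z (u z) = z"
    by (rule full_flow) (rule that)
  have uW: "u (W z s) = s" "W z s \<in> ball 0 1" if "z \<in> ball 0 1" "s \<in> {c<..<d}" for z s
    using u_along_traj_field[OF W(1)[OF that(1)] u_range[OF that(1)] _ that(2)] W(2)[OF that(1)]
      ode_solutionD(3)[OF W(1)[OF that(1)] that(2)] by simp_all
  have isCont_W: "isCont (\<lambda>x. W (fst x) (snd x)) (z, s)" if "z \<in> ball 0 1" "s \<in> {c<..<d}" for z s
    by (rule ode_flow_isCont[OF lipschitz_traj_field open_ball W u_range uW(1) u_continuous that])
  have conn: "connected ((\<lambda>z. W z (h z)) ` ball 0 1)"
    if h: "\<And>z. z \<in> ball 0 1 \<Longrightarrow> isCont h z \<and> h z \<in> {c<..<d}" for h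
  proof (intro connected_continuous_image continuous_at_imp_continuous_on ballI connected_ball)
    fix z :: complex assume z: "z \<in> ball 0 1"
    have "isCont (\<lambda>z. (z, h z)) z" using h[OF z] by (intro continuous_intros) auto
    from isCont_o2[OF this isCont_W[OF z]] h[OF z] show "isCont (\<lambda>z. W z (h z)) z" by simp
  qed
  have "superlevel_set \<phi> t = (\<lambda>z. W z (max t (u z))) ` ball 0 1"
  proof
    show "superlevel_set \<phi> t \<subseteq> (\<lambda>z. W z (max t (u z))) ` ball 0 1"
    proof
      fix z assume "z \<in> superlevel_set \<phi> t"
      then have "z \<in> ball 0 1" "max t (u z) = u z" by (auto simp: superlevel_set_def)
      then show "z \<in> (\<lambda>z. W z (max t (u z))) ` ball 0 1" using W(2) by force
    qed
    have "max t (u z) \<in> {c<..<d}" if "z \<in> ball 0 1" for z using u_range[OF that] t by auto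
    then show "(\<lambda>z. W z (max t (u z))) ` ball 0 1 \<subseteq> superlevel_set \<phi> t"
      using uW by (auto simp: superlevel_set_def)
  qed
  moreover have "connected ((\<lambda>z. W z (max t (u z))) ` ball 0 1)"
    using u_range t by (intro conn conjI continuous_max continuous_const u_isCont) (auto simp: max_def)
  ultimately show "connected (superlevel_set \<phi> t)" by simp
  have lev: "level_set \<phi> t = (\<lambda>z. W z t) ` ball 0 1"
  proof
    show "level_set \<phi> t \<subseteq> (\<lambda>z. W z t) ` ball 0 1"
      using W(2) by (force simp: level_set_def)
    show "(\<lambda>z. W z t) ` ball 0 1 \<subseteq> level_set \<phi> t"
      using uW[OF _ t] by (auto simp: level_set_def)
  qed
  then show "connected (level_set \<phi> t)" using conn[of "\<lambda>_. t"] t by simp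
  show "level_set \<phi> t \<noteq> {}" unfolding lev by auto
qed

definition end_set :: "complex set" where
  "end_set = (\<Inter>t\<in>{c<..<d}. closure (superlevel_set \<phi> t))"

lemma c_less_d: "c < d" using u_range[of 0] by auto

lemma closure_superlevel_compact: "compact (closure (superlevel_set \<phi> t))"
  by (rule compact_closure[THEN iffD2])
    (rule bounded_subset[OF bounded_ball[of 0 1]], auto simp: superlevel_set_def)

lemma end_set_compact: "compact end_set"
proof -
  obtain t where t: "t \<in> {c<..<d}" using c_less_d dense by auto
  have "closed end_set" unfolding end_set_def by (intro closed_INT) auto
  moreover have "end_set \<subseteq> closure (superlevel_set \<phi> t)" using t by (auto simp: end_set_def)
  ultimately show ?thesis
    using closure_superlevel_compact bounded_subset compact_imp_bounded by (metis compact_eq_bounded_closed)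
qed

lemma end_set_connected: "connected end_set"
  unfolding end_set_def
proof (rule connected_chain)
  fix X assume "X \<in> (\<lambda>t. closure (superlevel_set \<phi> t)) ` {c<..<d}"
  then show "compact X \<and> connected X"
    using closure_superlevel_compact connected_sets(1) connected_imp_connected_closure by blast
next
  fix X Y assume "X \<in> (\<lambda>t. closure (superlevel_set \<phi> t)) ` {c<..<d} \<and>
    Y \<in> (\<lambda>t. closure (superlevel_set \<phi> t)) ` {c<..<d}"
  then obtain s t where "X = closure (superlevel_set \<phi> s)" "Y = closure (superlevel_set \<phi> t)" by auto
  moreover have "superlevel_set \<phi> s \<subseteq> superlevel_set \<phi> t \<or> superlevel_set \<phi> t \<subseteq> superlevel_set \<phi> s"
    by (cases s t rule: linorder_le_cases) (auto simp: superlevel_set_def)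
  ultimately show "X \<subseteq> Y \<or> Y \<subseteq> X" using closure_mono by metis
qed

text \<open>
  Inside the disc \<open>u z < d\<close>, so a whole neighbourhood of \<open>z\<close> avoids \<open>superlevel_set \<phi> t\<close> as soon as
  \<open>u z < t\<close>.
\<close>

lemma end_set_subset_circle: "end_set \<subseteq> sphere 0 1"
proof
  fix z assume z: "z \<in> end_set"
  obtain t0 where "t0 \<in> {c<..<d}" using c_less_d dense by auto
  with z have "z \<in> closure (superlevel_set \<phi> t0)" by (auto simp: end_set_def)
  moreover have "closure (superlevel_set \<phi> t0) \<subseteq> cball 0 1"
    by (rule closure_minimal) (auto simp: superlevel_set_def)
  ultimately have le: "cmod z \<le> 1" by auto
  moreover have "\<not> cmod z < 1"
  proof
    assume "cmod z < 1"
    then have zD: "z \<in> ball 0 1" by simp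
    obtain t where t: "u z < t" "t < d" using u_range[OF zD] dense by auto
    let ?U = "ball 0 1 \<inter> u -` {..<t}"
    have "open ?U" by (intro continuous_open_preimage u_continuous) auto
    moreover have "z \<in> ?U" using zD t by auto
    moreover have "?U \<inter> superlevel_set \<phi> t = {}" by (auto simp: superlevel_set_def)
    ultimately have "z \<notin> closure (superlevel_set \<phi> t)" by (metis disjoint_iff open_Int_closure_eq_empty)
    moreover have "t \<in> {c<..<d}" using t u_range[OF zD] by auto
    ultimately show False using z by (auto simp: end_set_def)
  qed
  ultimately show "z \<in> sphere 0 1" by auto
qed

text \<open>
  The part of the trajectory up to a time \<open>s < d\<close> is compact, so a limit point outside the trajectory
  is a limit of the part after \<open>s\<close>, which lies in \<open>superlevel_set \<phi> t\<close> for \<open>t \<le> s\<close>.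
\<close>

lemma trajectory_ends_on_end_set:
  assumes w: "trajectory \<phi> z0 a b w"
  shows "ends_on \<phi> z0 b w end_set"
proof -
  have ab: "a = c" "b = d" using full[OF w] by auto
  have z0: "z0 \<in> ball 0 1" and ivp: "ivp_solution \<phi> z0 a b w"
    using w unfolding trajectory_def traj_dom_eq by auto
  have sol: "ode_solution traj_field (ball 0 1) {c<..<d} w" "u z0 \<in> {c<..<d}"
    using ivp_solution_iff[OF z0] ivp ab by auto
  have "p \<in> closure (superlevel_set \<phi> t)"
    if p: "p \<in> closure (w ` {u z0..<d})" "p \<notin> w ` {u z0..<d}" and t: "t \<in> {c<..<d}" for p t
  proof -
    define s where "s = max t (u z0)"
    have s: "u z0 \<le> s" "t \<le> s" "s < d" using t sol(2) by (auto simp: s_def)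
    have "{u z0..<d} = {u z0..s} \<union> {s..<d}" using s by auto
    then have "closure (w ` {u z0..<d}) = closure (w ` {u z0..s}) \<union> closure (w ` {s..<d})"
      by (metis image_Un closure_Un)
    moreover have "closure (w ` {u z0..s}) = w ` {u z0..s}"
    proof (intro closure_closed compact_imp_closed compact_continuous_image)
      show "continuous_on {u z0..s} w"
        by (rule continuous_on_subset[OF ode_solutionD(6)[OF sol(1)]]) (use sol(2) s in auto)
    qed auto
    moreover have "w ` {u z0..s} \<subseteq> w ` {u z0..<d}" using s by (intro image_mono) auto
    ultimately have "p \<in> closure (w ` {s..<d})" using p by auto
    moreover have "w ` {s..<d} \<subseteq> superlevel_set \<phi> t"
    proof
      fix x assume "x \<in> w ` {s..<d}"
      then obtain r where r: "r \<in> {s..<d}" "x = w r" by auto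
      then have "r \<in> {a<..<b}" using s sol(2) ab by auto
      from u_along_trajectory[OF w this] r s show "x \<in> superlevel_set \<phi> t"
        by (auto simp: superlevel_set_def)
    qed
    ultimately show ?thesis using closure_mono by blast
  qed
  then show ?thesis
    unfolding ends_on_def forward_part_def end_set_def ab by blast
qed

end

section \<open>Level sets and ends of trajectories\<close>

theorem theorem2p3:
  fixes \<phi> :: "complex \<Rightarrow> complex" and c d :: real and B :: "complex set"
  assumes "\<phi> analytic_on ball 0 1"
    and "\<not> \<phi> constant_on ball 0 1"
    and "\<phi> ` ball 0 1 \<subseteq> ball 0 1"
    and "locally_univalent_on \<phi> (ball 0 1)"
    and "\<forall>z\<in>ball 0 1. A_fun \<phi> z \<noteq> 0"
    and "c = (INF z\<in>ball 0 1. cmod (hyp_deriv \<phi> z))"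
    and "d = (SUP z\<in>ball 0 1. cmod (hyp_deriv \<phi> z))"
    and "\<forall>z0 \<omega>1 \<omega>2 w. trajectory \<phi> z0 \<omega>1 \<omega>2 w \<longrightarrow> \<omega>1 = c \<and> \<omega>2 = d"
    and "B = (\<Inter>t\<in>{c<..<d}. closure (superlevel_set \<phi> t))"
  shows "(\<forall>t\<in>{c<..<d}. open_Jordan_arc (level_set \<phi> t)) \<and>
    compact B \<and> connected B \<and> B \<subseteq> sphere 0 1 \<and>
    (\<forall>z0 \<omega>1 \<omega>2 w. trajectory \<phi> z0 \<omega>1 \<omega>2 w \<longrightarrow> ends_on \<phi> z0 \<omega>2 w B)"
proof -
  have hol: "\<phi> holomorphic_on ball 0 1"
    using assms(1) by (rule analytic_imp_holomorphic)
  interpret full_trajectories \<phi> c d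
  proof
    fix z :: complex assume z: "z \<in> ball 0 1"
    obtain U where U: "open U" "z \<in> U" "U \<subseteq> ball 0 1" "inj_on \<phi> U"
      using assms(4) z unfolding locally_univalent_on_def by blast
    show "deriv \<phi> z \<noteq> 0"
      by (rule holomorphic_injective_imp_regular[OF holomorphic_on_subset[OF hol U(3)] U(1,4,2)])
  next
    show "a = c \<and> b = d" if "trajectory \<phi> z0 a b w" for z0 a b w
      using assms(8) that by blast
  qed (use assms(3,5) hol in auto)
  have "B = end_set" using assms(9) by (simp add: end_set_def)
  then show ?thesis
    using connected_level_set_arc connected_sets end_set_compact end_set_connected
      end_set_subset_circle trajectory_ends_on_end_set by blast
qed

end
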